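(* Let $(X,T)$ be a Cantor minimal system of finite rank $d$ and $\mu$ a $T$-ergodic probability measure. Assume $(X,T)$ is given by a clean Bratteli-Vershik representation (with $d$ vertices per level). If $\lambda=\exp(2i\pi\alpha)$, $\alpha\in\mathbb{R}$, is an eigenvalue of $(X,T,\mu)$, then for $n\geq 1$ there exist real numbers $\rho_1(n),\dots,\rho_d(n)$ such that the series $$\sum_{n\geq 1}\ \max_{(l,k)\in J}\ \frac{1}{M_{k,l}(n+1)}\sum_{s\in S_n(l,k)}\left|1-\lambda^{\langle s,H(n)\rangle-\rho_k(n+1)+\rho_l(n)}\right|^2$$ converges, where $J=\{(l,k)\in\{1,\dots,d\}^2:\ \liminf_{n\to\infty}\mu\{\tau_n=l,\tau_{n+1}=k\}>0\}$.
   Context: A Cantor minimal system $(X,T)$ is a homeomorphism $T$ of a Cantor set $X$ all of whose orbits are dense. $\lambda$ is an eigenvalue of $(X,T,\mu)$ if there is $f\in L^2(X,\mu)$, $f\ne0$, with $f\circ T=\lambda f$ $\mu$-a.e. For $t\in\mathbb{R}$, $\lambda^t=\exp(2i\pi\alpha t)$. A maximum over the empty set is $0$. Bratteli-Vershik representations. A Bratteli diagram is an infinite graph with vertex set $V=\bigsqcup_{n\ge0}V_n$ and edge set $E=\bigsqcup_{n\ge1}E_n$, all levels finite, $V_0=\{v_0\}$; here $V_n=\{1,\dots,d\}$ for $n\ge1$; edges in $E_n$ go from $V_{n-1}$ (initial point) to $V_n$ (end-point); every vertex of $V_n$, $n\ge1$, is the end-point of an edge of $E_n$ and every vertex of $V_n$,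 $n\ge 0$, is the initial point of an edge of $E_{n+1}$. It is ordered by a partial order $\preceq$ on $E$ for which two edges are comparable iff they have the same end-point. $X_B$ is the compact space of infinite paths $(e_1,e_2,\dots)$, $e_n\in E_n$, starting at $v_0$, with basis the cylinder sets $[e_1,\dots,e_n]$. The diagram is properly ordered if there is exactly one path $x_{\max}$ all of whose edges are maximal and exactly one path $x_{\min}$ all of whose edges are minimal. The Vershik map $V_B$ sends $x_{\max}$ to $x_{\min}$ and, for $x\ne x_{\max}$, if $k$ is least with $x_k$ not maximal, sends $x$ to $(y_1,\dots,y_{k-1},y_k,x_{k+1},\dots)$ where $y_k$ is the successor of $x_k$ and $(y_1,\dots,y_{k-1})$ is the path of minimal edges from $v_0$ to the initial point of $y_k$. $(X,T)$ is given by $B$ if $B$ is properly ordered and $(X,T)=(X_B,V_B)$ up to conjugacy. $(X,T)$ is of finite rank $d$ if it admits such a representation with at most $d$ vertices per level; as the paper does, one takes exactly $d$ vertices per level. For $n\ge2$, $M(n)$ is the matrix whose $(i,j)$ entry $M_{i,j}(n)$ is the number of edges in $E_n$ from $j\in V_{n-1}$ to $i\in V_n$. Standing assumptions: all entries of each $M(n)$ are positive, and there is exactly one edge from $v_0$ to each vertex of $V_1$, so $H(1)=(1,\dots,1)^T$. Put $P(1)=I$, $P(n)=M(n)\cdots M(2)$, and $H(n)=P(n)H(1)=(h_1(n),\dots,h_d(n))^T$. For $x=(x_1,x_2,\dots)\in X$, $\tau_n(x)\in V_n$ is the vertex of level $n$ through which the path $x$ passes. The suffix map $s_n:X\to\mathbb{N}^{d}$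 is defined by letting $(s_n(x))_k$ be the number of edges $e\in E_{n+1}$ with initial vertex $k$ such that $x_{n+1}\preceq e$ and $x_{n+1}\neq e$. For $l,k\in\{1,\dots,d\}$, $S_n(l,k)=\{s_n(x): x\in X,\ \tau_n(x)=l,\ \tau_{n+1}(x)=k\}$. The representation is clean (for $\mu$) if there is $I\subseteq\{1,\dots,d\}$ such that $\liminf_{n\to\infty}\mu\{\tau_n=k\}>0$ for all $k\in I$, and $\sum_{n\ge1}\mu\{\tau_n=k\}<\infty$ for all $k\in I^c$. *)

theory Defs
  imports "HOL-Probability.Probability"
begin

section \<open>Cantor minimal systems, ergodic measures, eigenvalues\<close>

definition cantor_set :: "'a topology \<Rightarrow> bool" where
  "cantor_set X \<longleftrightarrow>
     X homeomorphic_space product_topology (\<lambda>_::nat. discrete_topology (UNIV :: bool set)) UNIV"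

text \<open>The map is invertible on the space, so \<open>(T ^^ n) y = x\<close> says that \<open>y\<close> is the
  point \<open>T\<close> to the power \<open>-n\<close> of \<open>x\<close>.\<close>

definition orbit :: "'a topology \<Rightarrow> ('a \<Rightarrow> 'a) \<Rightarrow> 'a \<Rightarrow> 'a set" where
  "orbit X T x = {y \<in> topspace X. \<exists>n. y = (T ^^ n) x \<or> (T ^^ n) y = x}"

definition cantor_minimal_system :: "'a topology \<Rightarrow> ('a \<Rightarrow> 'a) \<Rightarrow> bool" where
  "cantor_minimal_system X T \<longleftrightarrow>
     cantor_set X \<and> homeomorphic_map X X T \<and>
     (\<forall>x\<in>topspace X. X closure_of orbit X T x = topspace X)"

definition borel_prob_measure :: "'a topology \<Rightarrow> 'a measure \<Rightarrow> bool" where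
  "borel_prob_measure X \<mu> \<longleftrightarrow>
     prob_space \<mu> \<and> space \<mu> = topspace X \<and>
     sets \<mu> = sigma_sets (topspace X) {U. openin X U}"

definition ergodic :: "('a \<Rightarrow> 'a) \<Rightarrow> 'a measure \<Rightarrow> bool" where
  "ergodic T \<mu> \<longleftrightarrow>
     T \<in> measurable \<mu> \<mu> \<and> distr \<mu> \<mu> T = \<mu> \<and>
     (\<forall>A\<in>sets \<mu>. T -` A \<inter> space \<mu> = A \<longrightarrow> measure \<mu> A = 0 \<or> measure \<mu> A = 1)"

definition eigenvalue_of :: "('a \<Rightarrow> 'a) \<Rightarrow> 'a measure \<Rightarrow> complex \<Rightarrow> bool" where
  "eigenvalue_of T \<mu> c \<longleftrightarrow>
     (\<exists>f :: 'a \<Rightarrow> complex.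
        f \<in> borel_measurable \<mu> \<and> integrable \<mu> (\<lambda>x. (cmod (f x))\<^sup>2) \<and>
        \<not> (AE x in \<mu>. f x = 0) \<and> (AE x in \<mu>. f (T x) = c * f x))"

section \<open>Ordered Bratteli diagrams\<close>

text \<open>All data are indexed by the level, so the edge sets need not be disjoint as sets, and
  \<open>V\<close> and \<open>E\<close> are the disjoint unions of the levels. Only the levels \<open>n \<ge> 1\<close> of the fields
  below are meaningful; an edge \<open>e \<in> edges B n\<close> goes from \<open>src B n e\<close> in level \<open>n - 1\<close> to
  \<open>tgt B n e\<close> in level \<open>n\<close>, and \<open>edge_ord B n\<close> is the part of the partial order that lives on
  level \<open>n\<close> (edges of different levels have different end-points and are never comparable).\<close>

record 'e bratteli =
  edges :: "nat \<Rightarrow> 'e set"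
  src :: "nat \<Rightarrow> 'e \<Rightarrow> nat"
  tgt :: "nat \<Rightarrow> 'e \<Rightarrow> nat"
  edge_ord :: "nat \<Rightarrow> 'e rel"

definition vertices :: "nat \<Rightarrow> nat \<Rightarrow> nat set" where
  "vertices d n = (if n = 0 then {0} else {1..d})"

definition bratteli_diagram :: "nat \<Rightarrow> 'e bratteli \<Rightarrow> bool" where
  "bratteli_diagram d B \<longleftrightarrow>
     (\<forall>n\<ge>1. finite (edges B n)) \<and>
     (\<forall>n\<ge>1. \<forall>e\<in>edges B n. src B n e \<in> vertices d (n - 1) \<and> tgt B n e \<in> vertices d n) \<and>
     (\<forall>n\<ge>1. \<forall>v\<in>vertices d n. \<exists>e\<in>edges B n. tgt B n e = v) \<and>
     (\<forall>n. \<forall>v\<in>vertices d n. \<exists>e\<in>edges B (n + 1). src B (n + 1) e = v)"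

definition ordered_bratteli_diagram :: "nat \<Rightarrow> 'e bratteli \<Rightarrow> bool" where
  "ordered_bratteli_diagram d B \<longleftrightarrow>
     bratteli_diagram d B \<and>
     (\<forall>n\<ge>1. partial_order_on (edges B n) (edge_ord B n) \<and>
        (\<forall>e\<in>edges B n. \<forall>f\<in>edges B n.
           (e, f) \<in> edge_ord B n \<or> (f, e) \<in> edge_ord B n \<longleftrightarrow> tgt B n e = tgt B n f))"

definition max_edge :: "'e bratteli \<Rightarrow> nat \<Rightarrow> 'e \<Rightarrow> bool" where
  "max_edge B n e \<longleftrightarrow> e \<in> edges B n \<and> (\<forall>f\<in>edges B n. (e, f) \<in> edge_ord B n \<longrightarrow> f = e)"

definition min_edge :: "'e bratteli \<Rightarrow> nat \<Rightarrow> 'e \<Rightarrow> bool" where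
  "min_edge B n e \<longleftrightarrow> e \<in> edges B n \<and> (\<forall>f\<in>edges B n. (f, e) \<in> edge_ord B n \<longrightarrow> f = e)"

definition edge_succ :: "'e bratteli \<Rightarrow> nat \<Rightarrow> 'e \<Rightarrow> 'e" where
  "edge_succ B n e =
     (THE f. f \<in> edges B n \<and> (e, f) \<in> edge_ord B n \<and> f \<noteq> e \<and>
        (\<forall>g\<in>edges B n. (e, g) \<in> edge_ord B n \<and> g \<noteq> e \<longrightarrow> (f, g) \<in> edge_ord B n))"

section \<open>The path space and the Vershik map\<close>

text \<open>A path \<open>(e\<^sub>1, e\<^sub>2, \<dots>)\<close> is a function on the positive integers, with the usual dummy
  value at \<open>0\<close>. Starting at the top vertex is automatic, as it is the only vertex of level \<open>0\<close>.\<close>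

definition paths :: "'e bratteli \<Rightarrow> (nat \<Rightarrow> 'e) set" where
  "paths B = {x \<in> (\<Pi>\<^sub>E n\<in>{1..}. edges B n). \<forall>n\<ge>1. tgt B n (x n) = src B (n + 1) (x (n + 1))}"

definition cylinder :: "'e bratteli \<Rightarrow> nat \<Rightarrow> (nat \<Rightarrow> 'e) \<Rightarrow> (nat \<Rightarrow> 'e) set" where
  "cylinder B n e = {x \<in> paths B. \<forall>i\<in>{1..n}. x i = e i}"

definition path_topology :: "'e bratteli \<Rightarrow> (nat \<Rightarrow> 'e) topology" where
  "path_topology B = topology_generated_by {cylinder B n e | n e. e \<in> paths B}"

definition max_path :: "'e bratteli \<Rightarrow> (nat \<Rightarrow> 'e) \<Rightarrow> bool" where
  "max_path B x \<longleftrightarrow> x \<in> paths B \<and> (\<forall>n\<ge>1. max_edge B n (x n))"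

definition min_path :: "'e bratteli \<Rightarrow> (nat \<Rightarrow> 'e) \<Rightarrow> bool" where
  "min_path B x \<longleftrightarrow> x \<in> paths B \<and> (\<forall>n\<ge>1. min_edge B n (x n))"

definition properly_ordered :: "nat \<Rightarrow> 'e bratteli \<Rightarrow> bool" where
  "properly_ordered d B \<longleftrightarrow>
     ordered_bratteli_diagram d B \<and> (\<exists>!x. max_path B x) \<and> (\<exists>!x. min_path B x)"

definition vershik_map :: "'e bratteli \<Rightarrow> (nat \<Rightarrow> 'e) \<Rightarrow> (nat \<Rightarrow> 'e)" where
  "vershik_map B x =
     (if max_path B x then (THE y. min_path B y)
      else let k = (LEAST n. n \<ge> 1 \<and> \<not> max_edge B n (x n))
           in (THE y. y \<in> paths B \<and> (\<forall>i\<in>{1..<k}. min_edge B i (y i)) \<and>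
                 y k = edge_succ B k (x k) \<and> (\<forall>i>k. y i = x i)))"

text \<open>\<open>\<phi>\<close> is the conjugacy from \<open>(X, T)\<close> to the Bratteli-Vershik system of \<open>B\<close>.\<close>

definition given_by ::
  "'a topology \<Rightarrow> ('a \<Rightarrow> 'a) \<Rightarrow> nat \<Rightarrow> 'e bratteli \<Rightarrow> ('a \<Rightarrow> nat \<Rightarrow> 'e) \<Rightarrow> bool" where
  "given_by X T d B \<phi> \<longleftrightarrow>
     properly_ordered d B \<and> homeomorphic_map X (path_topology B) \<phi> \<and>
     (\<forall>x\<in>topspace X. \<phi> (T x) = vershik_map B (\<phi> x))"

section \<open>Incidence matrices, heights, suffixes\<close>

text \<open>For \<open>n \<ge> 2\<close> this is the entry in row \<open>i\<close> and column \<open>j\<close> of \<open>M(n)\<close>, with rows and columns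
  indexed by \<open>{1..d}\<close>; for \<open>n = 1\<close> and \<open>j = 0\<close> it counts the edges from the top vertex to \<open>i\<close>.\<close>

definition incidence :: "'e bratteli \<Rightarrow> nat \<Rightarrow> nat \<Rightarrow> nat \<Rightarrow> nat" where
  "incidence B n i j = card {e \<in> edges B n. src B n e = j \<and> tgt B n e = i}"

definition standing_assumptions :: "nat \<Rightarrow> 'e bratteli \<Rightarrow> bool" where
  "standing_assumptions d B \<longleftrightarrow>
     (\<forall>n\<ge>2. \<forall>i\<in>{1..d}. \<forall>j\<in>{1..d}. incidence B n i j > 0) \<and>
     (\<forall>i\<in>{1..d}. incidence B 1 i 0 = 1)"

text \<open>\<open>P(n) = M(n) \<cdots> M(2)\<close> for \<open>n \<ge> 1\<close>, the empty product \<open>P(1)\<close> being the identity; the value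
  at \<open>n = 0\<close> is a dummy.\<close>

fun incidence_prod :: "nat \<Rightarrow> 'e bratteli \<Rightarrow> nat \<Rightarrow> nat \<Rightarrow> nat \<Rightarrow> nat" where
  "incidence_prod d B 0 i j = 0"
| "incidence_prod d B (Suc 0) i j = (if i = j then 1 else 0)"
| "incidence_prod d B (Suc (Suc n)) i j =
     (\<Sum>k\<in>{1..d}. incidence B (Suc (Suc n)) i k * incidence_prod d B (Suc n) k j)"

definition height :: "nat \<Rightarrow> 'e bratteli \<Rightarrow> nat \<Rightarrow> nat \<Rightarrow> nat" where
  "height d B n i = (\<Sum>j\<in>{1..d}. incidence_prod d B n i j * incidence B 1 j 0)"

definition path_vertex :: "'e bratteli \<Rightarrow> nat \<Rightarrow> (nat \<Rightarrow> 'e) \<Rightarrow> nat" where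
  "path_vertex B n x = (if n = 0 then 0 else tgt B n (x n))"

definition suffix_vec :: "nat \<Rightarrow> 'e bratteli \<Rightarrow> nat \<Rightarrow> (nat \<Rightarrow> 'e) \<Rightarrow> (nat \<Rightarrow> nat)" where
  "suffix_vec d B n x =
     (\<lambda>k\<in>{1..d}. card {e \<in> edges B (n + 1). src B (n + 1) e = k \<and>
                          (x (n + 1), e) \<in> edge_ord B (n + 1) \<and> x (n + 1) \<noteq> e})"

definition suffix_set :: "nat \<Rightarrow> 'e bratteli \<Rightarrow> nat \<Rightarrow> nat \<Rightarrow> nat \<Rightarrow> (nat \<Rightarrow> nat) set" where
  "suffix_set d B n l k =
     suffix_vec d B n ` {x \<in> paths B. path_vertex B n x = l \<and> path_vertex B (n + 1) x = k}"

definition height_pairing :: "nat \<Rightarrow> 'e bratteli \<Rightarrow> nat \<Rightarrow> (nat \<Rightarrow> nat) \<Rightarrow> nat" where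
  "height_pairing d B n s = (\<Sum>k\<in>{1..d}. s k * height d B n k)"

section \<open>Clean representations\<close>

text \<open>In what follows \<open>\<tau> n x\<close> is the vertex of level \<open>n\<close> of the path representing \<open>x\<close>. The
  summation over \<open>n \<ge> 1\<close> is shifted by one to start at \<open>0\<close>.\<close>

definition clean :: "nat \<Rightarrow> (nat \<Rightarrow> 'a \<Rightarrow> nat) \<Rightarrow> 'a measure \<Rightarrow> bool" where
  "clean d \<tau> \<mu> \<longleftrightarrow>
     (\<exists>I\<subseteq>{1..d}.
        (\<forall>k\<in>I. liminf (\<lambda>n. ereal (measure \<mu> {x \<in> space \<mu>. \<tau> n x = k})) > 0) \<and>
        (\<forall>k\<in>{1..d} - I. summable (\<lambda>n. measure \<mu> {x \<in> space \<mu>. \<tau> (Suc n) x = k})))"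

definition recurrent_pairs :: "nat \<Rightarrow> (nat \<Rightarrow> 'a \<Rightarrow> nat) \<Rightarrow> 'a measure \<Rightarrow> (nat \<times> nat) set" where
  "recurrent_pairs d \<tau> \<mu> =
     {(l, k) \<in> {1..d} \<times> {1..d}.
        liminf (\<lambda>n. ereal (measure \<mu> {x \<in> space \<mu>. \<tau> n x = l \<and> \<tau> (n + 1) x = k})) > 0}"

definition max_or_zero :: "real set \<Rightarrow> real" where
  "max_or_zero A = (if A = {} then 0 else Max A)"

text \<open>\<open>\<lambda>\<close> to the real power \<open>t\<close>, for \<open>\<lambda> = exp (2 i \<pi> \<alpha>)\<close>; it depends on the chosen \<open>\<alpha>\<close>.\<close>

definition exp_power :: "real \<Rightarrow> real \<Rightarrow> complex" where
  "exp_power \<alpha> t = exp (2 * \<i> * of_real pi * of_real \<alpha> * of_real t)"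

end

theory Submission
  imports Defs
begin

text \<open>By ergodicity an eigenfunction may be normalised to a function \<open>u\<close> of modulus 1. Let \<open>u\<^sub>n\<close> be
  its conditional expectation given the first \<open>n\<close> edges. It is constant on each floor of each tower
  of level \<open>n\<close>, and moving up one floor multiplies it by \<open>c\<close>; so it is determined by its value
  \<open>C\<^sub>n(l)\<close> on the top floor of tower \<open>l\<close>. The martingale increments \<open>u\<^sub>n\<^sub>+\<^sub>1 - u\<^sub>n\<close> are orthogonal, hence
  square summable, and on the set where the edge \<open>n + 1\<close> is \<open>e\<close>, from \<open>l\<close> to \<open>k\<close> and with suffix \<open>s\<close>,
  their modulus is that of \<open>c\<close> to the power \<open>- \<langle>s, H(n)\<rangle>\<close> times \<open>C\<^sub>n\<^sub>+\<^sub>1(k)\<close> minus \<open>C\<^sub>n(l)\<close>.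
  All edges from \<open>l\<close> to \<open>k\<close> carry the same mass. Since \<open>u\<^sub>n\<close> tends to \<open>u\<close>, the moduli of
  \<open>C\<^sub>n(l)\<close> and \<open>C\<^sub>n\<^sub>+\<^sub>1(k)\<close> are eventually at least 1/2 for \<open>(l, k) \<in> J\<close>, and \<open>\<rho>\<^sub>l(n)\<close> can be taken
  as the phase of \<open>C\<^sub>n(l)\<close>.\<close>

section \<open>Ordered Bratteli diagrams and the Vershik map\<close>

locale bratteli_vershik =
  fixes d :: nat and B :: "'e bratteli"
  assumes proper: "properly_ordered d B"
    and standing: "standing_assumptions d B"
begin

abbreviation "E \<equiv> edges B"
abbreviation "s \<equiv> src B"
abbreviation "t \<equiv> tgt B"
abbreviation "le \<equiv> edge_ord B"
abbreviation "h \<equiv> height d B"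

section \<open>The order on the edges into a vertex\<close>

lemma diagram: "bratteli_diagram d B"
  using proper by (simp add: properly_ordered_def ordered_bratteli_diagram_def)

lemma finite_edges: "n \<ge> 1 \<Longrightarrow> finite (E n)"
  using diagram by (simp add: bratteli_diagram_def)

lemma tgt_vertex: "n \<ge> 1 \<Longrightarrow> e \<in> E n \<Longrightarrow> t n e \<in> {1..d}"
  using diagram unfolding bratteli_diagram_def vertices_def
  by (metis not_one_le_zero)

lemma src_vertex: "n \<ge> 1 \<Longrightarrow> e \<in> E (Suc n) \<Longrightarrow> s (Suc n) e \<in> {1..d}"
  using diagram unfolding bratteli_diagram_def vertices_def
  by (metis diff_Suc_1 le_add1 not_one_le_zero plus_1_eq_Suc)

lemma ex_edge_into: "n \<ge> 1 \<Longrightarrow> v \<in> {1..d} \<Longrightarrow> \<exists>e\<in>E n. t n e = v"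
  using diagram unfolding bratteli_diagram_def vertices_def
  by (metis not_one_le_zero)

lemma src_one: "e \<in> E 1 \<Longrightarrow> s 1 e = 0"
  using diagram unfolding bratteli_diagram_def vertices_def by fastforce

lemma le_partial_order: "n \<ge> 1 \<Longrightarrow> partial_order_on (E n) (le n)"
  using proper by (simp add: properly_ordered_def ordered_bratteli_diagram_def)

lemma le_comparable:
  "n \<ge> 1 \<Longrightarrow> e \<in> E n \<Longrightarrow> f \<in> E n \<Longrightarrow> (e, f) \<in> le n \<or> (f, e) \<in> le n \<longleftrightarrow> t n e = t n f"
  using proper by (simp add: properly_ordered_def ordered_bratteli_diagram_def)

lemma le_edges: "n \<ge> 1 \<Longrightarrow> (e, f) \<in> le n \<Longrightarrow> e \<in> E n \<and> f \<in> E n"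
  using partial_order_onD(4)[OF le_partial_order] by blast

lemma le_tgt: "n \<ge> 1 \<Longrightarrow> (e, f) \<in> le n \<Longrightarrow> t n e = t n f"
  using le_edges le_comparable by blast

lemma le_refl: "n \<ge> 1 \<Longrightarrow> e \<in> E n \<Longrightarrow> (e, e) \<in> le n"
  using le_comparable by blast

lemma le_trans: "n \<ge> 1 \<Longrightarrow> (e, f) \<in> le n \<Longrightarrow> (f, g) \<in> le n \<Longrightarrow> (e, g) \<in> le n"
  using partial_order_onD(2)[OF le_partial_order] by (meson transD)

lemma le_antisym: "n \<ge> 1 \<Longrightarrow> (e, f) \<in> le n \<Longrightarrow> (f, e) \<in> le n \<Longrightarrow> e = f"
  using partial_order_onD(3)[OF le_partial_order] by (meson antisymD)

text \<open>Edges with a common end-point are pairwise comparable, so a minimal element of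
  \<open>Q\<close> is least. Minimal elements exist because a partial order on a finite set is
  well-founded.\<close>

lemma ex_least_edge:
  assumes "n \<ge> 1" "Q \<subseteq> {e \<in> E n. t n e = v}" "Q \<noteq> {}"
  shows "\<exists>e\<in>Q. \<forall>f\<in>Q. (e, f) \<in> le n"
proof -
  have "finite (le n)"
    using partial_order_onD(4)[OF le_partial_order] finite_edges assms(1)
    by (meson finite_SigmaI finite_subset)
  then have "wf (le n - Id)"
    using le_partial_order[OF assms(1)] by (rule partial_order_on_well_order_on)
  then obtain e where e: "e \<in> Q" "\<And>f. (f, e) \<in> le n - Id \<Longrightarrow> f \<notin> Q"
    using assms(3) by (metis wfE_min')
  moreover have "(e, f) \<in> le n" if "f \<in> Q" for f
    using e that assms(2) le_comparable[OF assms(1), of e f] by (cases "e = f") auto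
  ultimately show ?thesis by blast
qed

lemma edges_one_unique: "e \<in> E 1 \<Longrightarrow> f \<in> E 1 \<Longrightarrow> t 1 e = t 1 f \<Longrightarrow> e = f"
proof -
  assume e: "e \<in> E 1" "f \<in> E 1" "t 1 e = t 1 f"
  have "card {e' \<in> E 1. s 1 e' = 0 \<and> t 1 e' = t 1 e} = 1"
    using standing tgt_vertex[of 1 e] e unfolding standing_assumptions_def incidence_def by simp
  then obtain a where "{e' \<in> E 1. s 1 e' = 0 \<and> t 1 e' = t 1 e} = {a}"
    using card_1_singletonE by blast
  moreover have "e \<in> {e' \<in> E 1. s 1 e' = 0 \<and> t 1 e' = t 1 e}" "f \<in> {e' \<in> E 1. s 1 e' = 0 \<and> t 1 e' = t 1 e}"
    using e src_one by auto
  ultimately show ?thesis by auto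
qed

text \<open>The top vertex sends a single edge to each vertex of level 1, so the order on
  \<open>E 1\<close> is trivial. Hence the first non-maximal edge of a path has index at least
  2.\<close>

lemma max_edge_one: "e \<in> E 1 \<Longrightarrow> max_edge B 1 e"
  unfolding max_edge_def using edges_one_unique le_tgt[of 1] by fastforce

lemma min_edge_unique: "n \<ge> 1 \<Longrightarrow> min_edge B n e \<Longrightarrow> min_edge B n f \<Longrightarrow> t n e = t n f \<Longrightarrow> e = f"
  unfolding min_edge_def using le_comparable by metis

lemma ex_min_edge:
  assumes "n \<ge> 1" "v \<in> {1..d}"
  shows "\<exists>e. min_edge B n e \<and> t n e = v"
proof -
  obtain e where e: "e \<in> E n" "t n e = v" "\<forall>f\<in>{e \<in> E n. t n e = v}. (e, f) \<in> le n"
    using ex_least_edge[OF assms(1), of "{e \<in> E n. t n e = v}" v] ex_edge_into[OF assms] by blast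
  have "min_edge B n e"
    unfolding min_edge_def using e le_tgt[OF assms(1)] le_antisym[OF assms(1)] by blast
  then show ?thesis using e by blast
qed

text \<open>Justifies the definite description in \<open>edge_succ\<close>: the edges strictly above
  \<open>e\<close> form a nonempty set with a common end-point, whose least element is the
  successor.\<close>

lemma edge_succ:
  assumes "n \<ge> 1" "e \<in> E n" "\<not> max_edge B n e"
  shows "edge_succ B n e \<in> E n" "(e, edge_succ B n e) \<in> le n" "edge_succ B n e \<noteq> e"
    "\<And>g. (e, g) \<in> le n \<Longrightarrow> g \<noteq> e \<Longrightarrow> (edge_succ B n e, g) \<in> le n"
proof -
  let ?Q = "{f \<in> E n. (e, f) \<in> le n \<and> f \<noteq> e}"
  have "?Q \<noteq> {}" using assms unfolding max_edge_def by blast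
  moreover have "?Q \<subseteq> {f \<in> E n. t n f = t n e}" using le_tgt[OF assms(1)] by auto
  ultimately obtain f where f: "f \<in> ?Q" "\<forall>g\<in>?Q. (f, g) \<in> le n"
    using ex_least_edge[OF assms(1)] by meson
  have "edge_succ B n e = f"
    unfolding edge_succ_def
    by (rule the_equality) (use f le_antisym[OF assms(1)] in blast)+
  then show "edge_succ B n e \<in> E n" "(e, edge_succ B n e) \<in> le n" "edge_succ B n e \<noteq> e"
    "\<And>g. (e, g) \<in> le n \<Longrightarrow> g \<noteq> e \<Longrightarrow> (edge_succ B n e, g) \<in> le n"
    using f le_edges[OF assms(1)] by auto
qed

section \<open>Heights, and towers stacked from lower towers\<close>

lemma height_one: "i \<in> {1..d} \<Longrightarrow> h 1 i = 1"
  using standing by (simp add: height_def standing_assumptions_def sum.delta if_distrib[of "\<lambda>x. x * _"] cong: if_cong)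

lemma sum_edges_by_src:
  assumes "n \<ge> 1" "A \<subseteq> E (Suc n)"
  shows "(\<Sum>e\<in>A. g (s (Suc n) e)) = (\<Sum>k\<in>{1..d}. card {e \<in> A. s (Suc n) e = k} * (g k :: nat))"
proof -
  have "finite A" using assms finite_edges[of "Suc n"] finite_subset by auto
  then have "(\<Sum>e\<in>A. g (s (Suc n) e)) = (\<Sum>k\<in>{1..d}. \<Sum>e\<in>{e \<in> A. s (Suc n) e = k}. g (s (Suc n) e))"
    using assms src_vertex by (intro sum.group[symmetric]) auto
  then show ?thesis by simp
qed

text \<open>This is \<open>H(n+1) = M(n+1) H(n)\<close>, with the multiplicities unfolded into a sum
  over edges, so that suffix heights become partial sums of it.\<close>

lemma height_Suc:
  assumes "n \<ge> 1" "k \<in> {1..d}"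
  shows "h (Suc n) k = (\<Sum>e\<in>{e \<in> E (Suc n). t (Suc n) e = k}. h n (s (Suc n) e))"
proof -
  obtain m where n: "n = Suc m" using assms(1) by (cases n) auto
  have "h (Suc n) k = (\<Sum>j\<in>{1..d}. \<Sum>i\<in>{1..d}. incidence B (Suc n) k i * incidence_prod d B n i j * incidence B 1 j 0)"
    by (simp add: height_def n sum_distrib_right)
  also have "\<dots> = (\<Sum>i\<in>{1..d}. incidence B (Suc n) k i * h n i)"
    by (subst sum.swap) (simp add: height_def sum_distrib_left mult.assoc)
  also have "\<dots> = (\<Sum>e\<in>{e \<in> E (Suc n). t (Suc n) e = k}. h n (s (Suc n) e))"
    by (subst sum_edges_by_src[OF assms(1)]) (auto simp: incidence_def conj_ac)
  finally show ?thesis .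
qed

lemma height_pos:
  assumes "n \<ge> 1" "k \<in> {1..d}"
  shows "h n k > 0"
  using assms
proof (induction n arbitrary: k rule: dec_induct)
  case base
  then show ?case using height_one by simp
next
  case (step n)
  obtain e where e: "e \<in> E (Suc n)" "t (Suc n) e = k"
    using ex_edge_into[of "Suc n"] step.prems by auto
  have "h n (s (Suc n) e) > 0"
    using src_vertex[OF step.hyps(1) e(1)] step.IH by blast
  then show ?case
    using e step finite_edges[of "Suc n"] by (auto simp: height_Suc intro!: sum_pos2[of _ e])
qed

text \<open>The number \<open>\<langle>s\<^sub>n(x), H(n)\<rangle>\<close>, as a function of the edge \<open>x\<^sub>n\<^sub>+\<^sub>1\<close> and with the sum taken
  over edges instead of vertices.\<close>

definition suffix_height :: "nat \<Rightarrow> 'e \<Rightarrow> nat" where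
  "suffix_height n e = (\<Sum>f\<in>{f \<in> E (Suc n). (e, f) \<in> le (Suc n) \<and> e \<noteq> f}. h n (s (Suc n) f))"

lemma height_pairing_suffix_vec:
  "n \<ge> 1 \<Longrightarrow> height_pairing d B n (suffix_vec d B n x) = suffix_height n (x (Suc n))"
  unfolding height_pairing_def suffix_vec_def suffix_height_def
  by (subst sum_edges_by_src) (auto simp: conj_ac)

text \<open>A tower of level \<open>n + 1\<close> is a stack of towers of level \<open>n\<close>,
  one block for each edge into its vertex, larger edges nearer the top. Counted from the top, the
  block of \<open>e\<close> begins at \<open>suffix_height n e\<close>; adding the height of that
  block gives its far end.\<close>

lemma suffix_height_eq_sum_insert:
  assumes "n \<ge> 1" "e \<in> E (Suc n)"
  shows "h n (s (Suc n) e) + suffix_height n e =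
    (\<Sum>f\<in>{f \<in> E (Suc n). (e, f) \<in> le (Suc n)}. h n (s (Suc n) f))"
proof -
  have "{f \<in> E (Suc n). (e, f) \<in> le (Suc n)} =
      insert e {f \<in> E (Suc n). (e, f) \<in> le (Suc n) \<and> e \<noteq> f}"
    using assms le_refl[of "Suc n" e] by auto
  then show ?thesis
    using finite_edges[of "Suc n"] by (simp add: suffix_height_def)
qed

lemma suffix_height_le:
  assumes "n \<ge> 1" "e \<in> E (Suc n)"
  shows "h n (s (Suc n) e) + suffix_height n e \<le> h (Suc n) (t (Suc n) e)"
  using assms finite_edges[of "Suc n"] le_tgt[of "Suc n"] tgt_vertex[of "Suc n" e]
  by (auto simp: suffix_height_eq_sum_insert height_Suc intro!: sum_mono2)

lemma suffix_height_min_edge: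
  assumes "n \<ge> 1" "min_edge B (Suc n) e"
  shows "h n (s (Suc n) e) + suffix_height n e = h (Suc n) (t (Suc n) e)"
proof -
  have e: "e \<in> E (Suc n)" using assms(2) by (simp add: min_edge_def)
  have "{f \<in> E (Suc n). (e, f) \<in> le (Suc n)} = {f \<in> E (Suc n). t (Suc n) f = t (Suc n) e}"
    using assms(2) le_comparable[of "Suc n" e] e le_refl[of "Suc n" e] unfolding min_edge_def
    by (intro Collect_cong) (metis le_add1 plus_1_eq_Suc)
  then show ?thesis
    using assms(1) e tgt_vertex[of "Suc n" e] by (simp add: suffix_height_eq_sum_insert height_Suc)
qed

text \<open>All edges from \<open>f\<close> upward lie strictly above \<open>e\<close>, so the sum
  for \<open>e\<close> contains the whole block of \<open>f\<close>: blocks of different edges do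
  not overlap.\<close>

lemma suffix_height_less:
  assumes "n \<ge> 1" "(e, f) \<in> le (Suc n)" "e \<noteq> f"
  shows "h n (s (Suc n) f) + suffix_height n f \<le> suffix_height n e"
proof -
  have ef: "e \<in> E (Suc n)" "f \<in> E (Suc n)" using le_edges[OF _ assms(2)] by auto
  have "{g \<in> E (Suc n). (f, g) \<in> le (Suc n)} \<subseteq> {g \<in> E (Suc n). (e, g) \<in> le (Suc n) \<and> e \<noteq> g}"
    using assms le_trans[of "Suc n" e f] le_antisym[of "Suc n" e f] by auto
  then show ?thesis
    unfolding suffix_height_eq_sum_insert[OF assms(1) ef(2)] unfolding suffix_height_def
    using finite_edges[of "Suc n"] by (intro sum_mono2) auto
qed

text \<open>No edge lies strictly between \<open>e\<close> and its successor, so their blocks are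
  adjacent. This makes a carry of the Vershik map cost exactly one step.\<close>

lemma suffix_height_edge_succ:
  assumes "n \<ge> 1" "e \<in> E (Suc n)" "\<not> max_edge B (Suc n) e"
  defines "f \<equiv> edge_succ B (Suc n) e"
  shows "suffix_height n e = h n (s (Suc n) f) + suffix_height n f"
proof -
  note f = edge_succ[of "Suc n" e, OF _ assms(2,3), folded f_def, simplified]
  have "{g \<in> E (Suc n). (f, g) \<in> le (Suc n)} = {g \<in> E (Suc n). (e, g) \<in> le (Suc n) \<and> e \<noteq> g}"
    using f le_trans[of "Suc n" e f] le_antisym[of "Suc n" e f] by auto
  then show ?thesis
    unfolding suffix_height_eq_sum_insert[OF assms(1) f(1)] by (simp add: suffix_height_def)
qed

lemma suffix_height_max_edge: "max_edge B (Suc n) e \<Longrightarrow> suffix_height n e = 0"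
  unfolding suffix_height_def max_edge_def by (rule sum.neutral) auto

text \<open>Uniqueness of digits in a mixed-radix expansion: \<open>a\<close> and \<open>b\<close>
  are positions inside the blocks of \<open>e\<close> and \<open>f\<close>, and disjoint blocks
  share no position.\<close>

lemma suffix_height_digit_unique:
  assumes "n \<ge> 1" "e \<in> E (Suc n)" "f \<in> E (Suc n)" "t (Suc n) e = t (Suc n) f"
    and "a < h n (s (Suc n) e)" "b < h n (s (Suc n) f)"
    and "a + suffix_height n e = b + suffix_height n f"
  shows "e = f"
proof (rule ccontr)
  assume "e \<noteq> f"
  moreover have "(e, f) \<in> le (Suc n) \<or> (f, e) \<in> le (Suc n)"
    using le_comparable[of "Suc n" e f] assms by simp
  ultimately have "h n (s (Suc n) f) + suffix_height n f \<le> suffix_height n e \<or>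
      h n (s (Suc n) e) + suffix_height n e \<le> suffix_height n f"
    using suffix_height_less[OF assms(1)] by blast
  with assms(5-7) show False by linarith
qed

subsection \<open>Return times to the top of a tower\<close>

lemma path_edge: "x \<in> paths B \<Longrightarrow> n \<ge> 1 \<Longrightarrow> x n \<in> E n"
  unfolding paths_def by auto

lemma path_src: "x \<in> paths B \<Longrightarrow> n \<ge> 1 \<Longrightarrow> s (Suc n) (x (Suc n)) = t n (x n)"
  unfolding paths_def by auto

lemma path_vertex_eq: "n \<ge> 1 \<Longrightarrow> path_vertex B n x = t n (x n)"
  by (simp add: path_vertex_def)

lemma path_vertex_in: "x \<in> paths B \<Longrightarrow> n \<ge> 1 \<Longrightarrow> path_vertex B n x \<in> {1..d}"
  using path_edge tgt_vertex path_vertex_eq by metis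

text \<open>The number of steps that \<open>x\<close> needs to reach the top of its tower of level \<open>n\<close>, where
  \<open>x\<^sub>1, \<dots>, x\<^sub>n\<close> are maximal.\<close>

definition time_to_top :: "nat \<Rightarrow> (nat \<Rightarrow> 'e) \<Rightarrow> nat" where
  "time_to_top n x = (\<Sum>i\<in>{1..<n}. suffix_height i (x (Suc i)))"

lemma time_to_top_one: "time_to_top 1 x = 0"
  by (simp add: time_to_top_def)

lemma time_to_top_Suc: "n \<ge> 1 \<Longrightarrow> time_to_top (Suc n) x = time_to_top n x + suffix_height n (x (Suc n))"
  by (simp add: time_to_top_def)

lemma time_to_top_less:
  assumes "x \<in> paths B" "n \<ge> 1"
  shows "time_to_top n x < h n (path_vertex B n x)"
  using assms(2)
proof (induction n rule: dec_induct)
  case base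
  then show ?case
    using height_one path_vertex_in[OF assms(1), of 1] time_to_top_one by simp
next
  case (step n)
  then show ?case
    using suffix_height_le[of n "x (Suc n)"] path_edge[OF assms(1), of "Suc n"] path_src[OF assms(1), of n]
    by (simp add: time_to_top_Suc path_vertex_eq)
qed

text \<open>A minimal edge carries the lowest block of its tower, so a prefix of minimal edges sits
  on the bottom floor.\<close>

lemma time_to_top_min:
  assumes "x \<in> paths B" "n \<ge> 1" "\<forall>i\<in>{1..n}. min_edge B i (x i)"
  shows "Suc (time_to_top n x) = h n (path_vertex B n x)"
  using assms(2,3)
proof (induction n rule: dec_induct)
  case base
  then show ?case
    using height_one path_vertex_in[OF assms(1), of 1] time_to_top_one by simp
next
  case (step n)
  then show ?case
    using suffix_height_min_edge[of n "x (Suc n)"] path_src[OF assms(1), of n]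
    by (simp add: time_to_top_Suc path_vertex_eq)
qed

lemma time_to_top_max:
  assumes "\<forall>i\<in>{1..n}. max_edge B i (x i)"
  shows "time_to_top n x = 0"
  unfolding time_to_top_def
  using assms suffix_height_max_edge by (intro sum.neutral) auto

text \<open>A floor determines the first \<open>n\<close> edges. The last edge is read off as the
  leading digit of the time to the top; its source and the remaining time then determine the earlier
  edges by induction.\<close>

lemma time_to_top_inj:
  assumes "x \<in> paths B" "y \<in> paths B" "n \<ge> 1"
    and "path_vertex B n x = path_vertex B n y" "time_to_top n x = time_to_top n y"
  shows "\<forall>i\<in>{1..n}. x i = y i"
  using assms(3-5)
proof (induction n rule: dec_induct)
  case base
  then show ?case
    using edges_one_unique[of "x 1" "y 1"] path_edge assms(1,2) by (simp add: path_vertex_eq)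
next
  case (step n)
  have "x (Suc n) = y (Suc n)"
  proof (rule suffix_height_digit_unique[of n])
    show "x (Suc n) \<in> E (Suc n)" "y (Suc n) \<in> E (Suc n)"
      using path_edge assms(1,2) by auto
    show "time_to_top n x < h n (s (Suc n) (x (Suc n)))" "time_to_top n y < h n (s (Suc n) (y (Suc n)))"
      using time_to_top_less assms(1,2) step.hyps(1) by (simp_all add: path_src path_vertex_eq)
  qed (use step in \<open>simp_all add: time_to_top_Suc path_vertex_eq\<close>)
  moreover from this have "path_vertex B n x = path_vertex B n y"
    using path_src[OF assms(1) step.hyps(1)] path_src[OF assms(2) step.hyps(1)]
    by (simp add: path_vertex_eq[OF step.hyps(1)])
  moreover have "time_to_top n x = time_to_top n y"
    using step.prems step.hyps \<open>x (Suc n) = y (Suc n)\<close> by (simp add: time_to_top_Suc)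
  ultimately show ?case
    using step.IH by (metis atLeastAtMost_iff le_SucE)
qed

section \<open>The Vershik map as an odometer\<close>

lemma ex_min_prefix:
  assumes "n \<ge> 1" "v \<in> {1..d}"
  shows "\<exists>p. (\<forall>i\<in>{1..n}. min_edge B i (p i)) \<and> (\<forall>i\<in>{1..<n}. t i (p i) = s (Suc i) (p (Suc i)))
    \<and> t n (p n) = v"
  using assms
proof (induction n arbitrary: v rule: dec_induct)
  case base
  then obtain e where "min_edge B 1 e \<and> t 1 e = v" using ex_min_edge[of 1] by auto
  then show ?case by (intro exI[of _ "\<lambda>_. e"]) auto
next
  case (step n)
  then obtain e where e: "min_edge B (Suc n) e" "t (Suc n) e = v" using ex_min_edge[of "Suc n"] by auto
  then have "s (Suc n) e \<in> {1..d}" using src_vertex[OF step.hyps(1)] by (simp add: min_edge_def)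
  then obtain p where p: "\<forall>i\<in>{1..n}. min_edge B i (p i)"
     "\<forall>i\<in>{1..<n}. t i (p i) = s (Suc i) (p (Suc i))" "t n (p n) = s (Suc n) e"
    using step.IH by blast
  then show ?case
    using e by (intro exI[of _ "p(Suc n := e)"]) (auto simp: le_Suc_eq less_Suc_eq)
qed

text \<open>Traced backwards from level \<open>n\<close>, each vertex has only one minimal incoming
  edge. With \<open>ex_min_prefix\<close> this settles the prefix chosen by the Vershik map.\<close>

lemma min_prefix_unique:
  assumes "n \<ge> 1" "\<forall>i\<in>{1..n}. min_edge B i (x i)" "\<forall>i\<in>{1..n}. min_edge B i (y i)"
    and "\<forall>i\<in>{1..<n}. t i (x i) = s (Suc i) (x (Suc i))" "\<forall>i\<in>{1..<n}. t i (y i) = s (Suc i) (y (Suc i))"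
    and "t n (x n) = t n (y n)"
  shows "\<forall>i\<in>{1..n}. x i = y i"
  using assms
proof (induction n rule: dec_induct)
  case base
  then show ?case using min_edge_unique[of 1] by simp
next
  case (step n)
  then have "x (Suc n) = y (Suc n)" using min_edge_unique[of "Suc n"] by simp
  moreover have "\<forall>i\<in>{1..n}. x i = y i"
  proof (rule step.IH)
    show "t n (x n) = t n (y n)"
      using step.prems(3,4) step.hyps(1) \<open>x (Suc n) = y (Suc n)\<close> by simp
  qed (use step.prems in auto)
  ultimately show ?case by (auto simp: le_Suc_eq)
qed

text \<open>Evaluates the definite description in \<open>vershik_map\<close>. The successor has the
  same end-point as \<open>x k\<close>, so the old tail still fits, and the minimal prefix into its
  source exists and is unique.\<close>

lemma vershik_map_not_max:
  assumes x: "x \<in> paths B" "\<not> max_path B x"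
  defines "k \<equiv> LEAST n. n \<ge> 1 \<and> \<not> max_edge B n (x n)"
  shows "k \<ge> 2" "\<not> max_edge B k (x k)" "\<forall>i\<in>{1..<k}. max_edge B i (x i)"
    "\<forall>i\<in>{1..<k}. min_edge B i (vershik_map B x i)"
    "vershik_map B x k = edge_succ B k (x k)" "\<forall>i>k. vershik_map B x i = x i"
proof -
  have "\<exists>n. n \<ge> 1 \<and> \<not> max_edge B n (x n)" using x by (auto simp: max_path_def)
  from LeastI_ex[OF this] have k: "k \<ge> 1" "\<not> max_edge B k (x k)" by (auto simp: k_def)
  have lt: "\<forall>i\<in>{1..<k}. max_edge B i (x i)"
  proof
    fix i assume "i \<in> {1..<k}"
    then show "max_edge B i (x i)"
      using not_less_Least[of i "\<lambda>n. n \<ge> 1 \<and> \<not> max_edge B n (x n)"] by (simp add: k_def)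
  qed
  have k2: "k \<ge> 2"
    using k max_edge_one[OF path_edge[OF x(1), of 1]] by (cases "k = 1") auto
  then obtain m where m: "k = Suc m" "m \<ge> 1" by (cases k) auto
  let ?f = "edge_succ B k (x k)"
  have f: "?f \<in> E k" "(x k, ?f) \<in> le k"
    using edge_succ[OF k(1) path_edge[OF x(1) k(1)] k(2)] by auto
  have tf: "t k ?f = t k (x k)" using le_tgt[OF k(1) f(2)] by simp
  let ?P = "\<lambda>y. y \<in> paths B \<and> (\<forall>i\<in>{1..<k}. min_edge B i (y i)) \<and> y k = ?f \<and> (\<forall>i>k. y i = x i)"
  have "s k ?f \<in> {1..d}" using src_vertex[OF m(2)] f(1) m(1) by simp
  then obtain p where p: "\<forall>i\<in>{1..m}. min_edge B i (p i)"
     "\<forall>i\<in>{1..<m}. t i (p i) = s (Suc i) (p (Suc i))" "t m (p m) = s k ?f"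
    using ex_min_prefix[OF m(2)] by blast
  \<comment> \<open>The value at index 0 must be \<open>undefined\<close>, since paths are
    extensional functions on the positive integers.\<close>
  define y where "y i = (if i = 0 then undefined else if i < k then p i else if i = k then ?f else x i)" for i
  have py: "?P y"
  proof (intro conjI)
    have "y i \<in> E i" if "i \<ge> 1" for i
      using that p(1) f(1) path_edge[OF x(1)] m by (auto simp: y_def min_edge_def)
    moreover have "t i (y i) = s (i + 1) (y (i + 1))" if "i \<ge> 1" for i
    proof -
      consider "i < m" | "i = m" | "i = k" | "i > k" using m by linarith
      then show ?thesis
        using that p(2,3) tf path_src[OF x(1)] m by cases (auto simp: y_def)
    qed
    ultimately show "y \<in> paths B" by (auto simp: paths_def PiE_def extensional_def y_def)
  qed (use p m in \<open>auto simp: y_def\<close>)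
  have uniq: "z = y" if z: "?P z" for z
  proof
    fix i
    have z0: "z 0 = undefined" using z by (auto simp: paths_def PiE_def extensional_def)
    have "\<forall>i\<in>{1..m}. z i = y i"
    proof (rule min_prefix_unique[OF m(2)])
      show "\<forall>i\<in>{1..<m}. t i (z i) = s (Suc i) (z (Suc i))" "\<forall>i\<in>{1..<m}. t i (y i) = s (Suc i) (y (Suc i))"
        using z py path_src by auto
      show "t m (z m) = t m (y m)"
        using z py m path_src[of z m] path_src[of y m] by auto
    qed (use z py m in auto)
    then show "z i = y i"
      using z py m z0 by (cases "i = 0"; cases "i < k"; cases "i = k") (auto simp: y_def)
  qed
  have "vershik_map B x = (THE y. ?P y)"
    using x(2) by (simp add: vershik_map_def k_def Let_def)
  also have "\<dots> = y" using py uniq by (rule the_equality)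
  finally have "?P (vershik_map B x)" using py by simp
  then show "k \<ge> 2" "\<not> max_edge B k (x k)" "\<forall>i\<in>{1..<k}. max_edge B i (x i)"
    "\<forall>i\<in>{1..<k}. min_edge B i (vershik_map B x i)"
    "vershik_map B x k = edge_succ B k (x k)" "\<forall>i>k. vershik_map B x i = x i"
    using k k2 lt by auto
qed

text \<open>From a top floor the map reaches a bottom floor of the same level: either
  \<open>x\<close> is the maximal path, with the minimal path as image, or its first non-maximal
  index exceeds \<open>n\<close>.\<close>

lemma vershik_map_top:
  assumes x: "x \<in> paths B" and "n \<ge> 1" "\<forall>i\<in>{1..n}. max_edge B i (x i)"
  shows "\<forall>i\<in>{1..n}. min_edge B i (vershik_map B x i)"
proof (cases "max_path B x")
  case True
  have "min_path B (vershik_map B x)"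
    using True proper theI'[of "min_path B"] by (simp add: vershik_map_def properly_ordered_def)
  then show ?thesis by (simp add: min_path_def)
next
  case False
  define k where "k = (LEAST n. n \<ge> 1 \<and> \<not> max_edge B n (x n))"
  note V = vershik_map_not_max[OF x False, folded k_def]
  have "\<not> k \<le> n"
  proof
    assume "k \<le> n"
    then have "k \<in> {1..n}" using V(1) by simp
    then show False using assms(3) V(2) by blast
  qed
  then show ?thesis using V(4) by simp
qed

text \<open>The carry of an odometer. Before the first non-maximal index \<open>k\<close> the digits
  pass from all zero to all largest, at \<open>k\<close> the path enters the adjacent block, and
  beyond \<open>k\<close> nothing changes.\<close>

lemma vershik_map_not_top:
  assumes x: "x \<in> paths B" "vershik_map B x \<in> paths B" and n: "n \<ge> 1" "\<not> (\<forall>i\<in>{1..n}. max_edge B i (x i))"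
  shows "path_vertex B n (vershik_map B x) = path_vertex B n x"
    "Suc (time_to_top n (vershik_map B x)) = time_to_top n x"
proof -
  let ?y = "vershik_map B x"
  have nm: "\<not> max_path B x" using n by (auto simp: max_path_def)
  define k where "k = (LEAST n. n \<ge> 1 \<and> \<not> max_edge B n (x n))"
  note V = vershik_map_not_max[OF x(1) nm, folded k_def]
  obtain j where j: "1 \<le> j" "j \<le> n" "\<not> max_edge B j (x j)" using n(2) by auto
  have "k \<le> j" unfolding k_def using j by (intro Least_le) simp
  then have kn: "k \<le> n" using j(2) by simp
  obtain m where m: "k = Suc m" "m \<ge> 1" using V(1) by (cases k) auto
  have xk: "x k \<in> E k" using path_edge[OF x(1)] V(1) by simp
  have tk: "t k (?y k) = t k (x k)"
    using edge_succ(2)[of k "x k"] V xk le_tgt[of k "x k"] by auto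
  \<comment> \<open>The induction starts at level \<open>k\<close>, where the carry happens; later
    levels add the same digits on both sides.\<close>
  have "path_vertex B n ?y = path_vertex B n x \<and> Suc (time_to_top n ?y) = time_to_top n x"
    using kn
  proof (induction n rule: dec_induct)
    case base
    have "time_to_top m x = 0" using V(3) m by (intro time_to_top_max) auto
    moreover have "Suc (time_to_top m ?y) = h m (path_vertex B m ?y)"
      using V(4) m by (intro time_to_top_min x(2)) auto
    moreover have "path_vertex B m ?y = s k (?y k)"
      using path_src[OF x(2) m(2)] m by (simp add: path_vertex_eq)
    moreover have "suffix_height m (x k) = h m (s k (?y k)) + suffix_height m (?y k)"
      using suffix_height_edge_succ[OF m(2), of "x k"] xk V(2,5) m by simp
    ultimately show ?case
      using tk m by (simp add: time_to_top_Suc path_vertex_def)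
  next
    case (step i)
    then show ?case using V(1,6) by (simp add: time_to_top_Suc path_vertex_def)
  qed
  then show "path_vertex B n ?y = path_vertex B n x" "Suc (time_to_top n ?y) = time_to_top n x" by auto
qed

text \<open>The bound \<open>Suc r < h n l\<close> keeps floor \<open>r\<close> off the bottom of
  its tower. If \<open>x\<close> is on a top floor both sides fail: its own time is 0, and its image
  is on a bottom floor.\<close>

lemma vershik_map_level_iff:
  assumes x: "x \<in> paths B" "vershik_map B x \<in> paths B" and "n \<ge> 1" "Suc r < h n l"
  shows "path_vertex B n (vershik_map B x) = l \<and> time_to_top n (vershik_map B x) = r \<longleftrightarrow>
    path_vertex B n x = l \<and> time_to_top n x = Suc r"
proof (cases "\<forall>i\<in>{1..n}. max_edge B i (x i)")
  case True
  then show ?thesis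
    using time_to_top_max[OF True] time_to_top_min[OF x(2) assms(3) vershik_map_top[OF x(1) assms(3) True]]
      assms(4) by auto
next
  case False
  then show ?thesis
    using vershik_map_not_top[OF x assms(3) False] by auto
qed

text \<open>The floor \<open>suffix_height n e\<close> is the top of the block of \<open>e\<close>,
  so uniqueness of digits applies with remainder 0 for \<open>e\<close>.\<close>

lemma level_refine_iff:
  assumes x: "x \<in> paths B" and n: "n \<ge> 1" and e: "e \<in> E (Suc n)"
  shows "path_vertex B (Suc n) x = t (Suc n) e \<and> time_to_top (Suc n) x = suffix_height n e \<longleftrightarrow>
    x (Suc n) = e \<and> time_to_top n x = 0"
proof
  assume L: "path_vertex B (Suc n) x = t (Suc n) e \<and> time_to_top (Suc n) x = suffix_height n e"
  have "x (Suc n) = e"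
  proof (rule suffix_height_digit_unique[OF n])
    show "time_to_top n x < h n (s (Suc n) (x (Suc n)))"
      using time_to_top_less[OF x n] path_src[OF x n] n by (simp add: path_vertex_eq)
    show "0 < h n (s (Suc n) e)" using height_pos n src_vertex e by simp
  qed (use L path_edge x e n in \<open>auto simp: path_vertex_eq time_to_top_Suc\<close>)
  then show "x (Suc n) = e \<and> time_to_top n x = 0" using L n by (simp add: time_to_top_Suc)
qed (use n in \<open>auto simp: path_vertex_eq time_to_top_Suc\<close>)

end

section \<open>Kakutani-Rokhlin towers\<close>

locale vershik_system = bratteli_vershik d B
  for d :: nat and B :: "'e bratteli" +
  fixes X :: "'a topology" and T :: "'a \<Rightarrow> 'a" and \<mu> :: "'a measure" and \<phi> :: "'a \<Rightarrow> nat \<Rightarrow> 'e"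
  assumes borel: "borel_prob_measure X \<mu>"
    and T_measurable: "T \<in> measurable \<mu> \<mu>"
    and T_invariant: "distr \<mu> \<mu> T = \<mu>"
    and conjugacy: "given_by X T d B \<phi>"
begin

sublocale prob_space \<mu>
  using borel by (simp add: borel_prob_measure_def)

section \<open>Topology and measurability on the path space\<close>

lemma space_eq: "space \<mu> = topspace X"
  using borel by (simp add: borel_prob_measure_def)

lemma openin_sets: "openin X U \<Longrightarrow> U \<in> sets \<mu>"
  using borel by (auto simp: borel_prob_measure_def)

lemma cylinder_mono: "m \<le> n \<Longrightarrow> cylinder B n x \<subseteq> cylinder B m x"
  by (auto simp: cylinder_def)

lemma cylinder_self: "x \<in> paths B \<Longrightarrow> x \<in> cylinder B n x"
  by (auto simp: cylinder_def)

lemma topspace_path_topology: "topspace (path_topology B) = paths B"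
  by (auto simp: path_topology_def cylinder_def)

lemma phi_homeomorphic: "homeomorphic_map X (path_topology B) \<phi>"
  using conjugacy by (simp add: given_by_def)

lemma phi_path: "x \<in> space \<mu> \<Longrightarrow> \<phi> x \<in> paths B"
  using homeomorphic_imp_surjective_map[OF phi_homeomorphic]
  by (auto simp: topspace_path_topology space_eq)

lemma T_space: "x \<in> space \<mu> \<Longrightarrow> T x \<in> space \<mu>"
  using T_measurable by (auto simp: measurable_def)

lemma phi_T: "x \<in> space \<mu> \<Longrightarrow> \<phi> (T x) = vershik_map B (\<phi> x)"
  using conjugacy by (simp add: given_by_def space_eq)

lemma open_prefix_set:
  assumes "U \<subseteq> paths B" "\<And>x. x \<in> U \<Longrightarrow> cylinder B n x \<subseteq> U"
  shows "openin (path_topology B) U"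
proof -
  have "openin (path_topology B) (cylinder B n x)" if "x \<in> U" for x
    using that assms(1) unfolding path_topology_def
    by (intro topology_generated_by_Basis) auto
  then have "openin (path_topology B) (\<Union>(cylinder B n ` U))"
    by blast
  moreover have "\<Union>(cylinder B n ` U) = U"
    using assms cylinder_self by blast
  ultimately show ?thesis by simp
qed

text \<open>The cylinders around a point are nested, so the property survives finite intersections
  in the induction over the generated topology.\<close>

lemma open_contains_cylinder:
  assumes "openin (path_topology B) U" "x \<in> U"
  shows "\<exists>n. cylinder B n x \<subseteq> U"
proof -
  have "generate_topology_on {cylinder B n e | n e. e \<in> paths B} U"
    using assms(1) unfolding path_topology_def by (rule openin_topology_generated_by)
  then show ?thesis
    using assms(2)
  proof (induction arbitrary: x)
    case (Int a b)
    then obtain m n where "cylinder B m x \<subseteq> a" "cylinder B n x \<subseteq> b" by blast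
    then show ?case
      using cylinder_mono[of m "max m n" x] cylinder_mono[of n "max m n" x]
      by (intro exI[of _ "max m n"]) auto
  next
    case (UN K)
    then show ?case by (metis Union_upper UnionE subset_trans)
  next
    case (Basis b)
    then obtain n e where "b = cylinder B n e" by blast
    then show ?case using Basis by (intro exI[of _ n]) (auto simp: cylinder_def)
  qed simp
qed

text \<open>A property of the first \<open>n\<close> edges defines a union of cylinders, which is
  open; its preimage under the conjugacy is open in \<open>X\<close>, hence measurable.\<close>

lemma prefix_sets:
  assumes "\<And>x y. x \<in> paths B \<Longrightarrow> y \<in> paths B \<Longrightarrow> \<forall>i\<in>{1..n}. x i = y i \<Longrightarrow> P x \<Longrightarrow> P y"
  shows "{x \<in> space \<mu>. P (\<phi> x)} \<in> sets \<mu>"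
proof -
  have "openin (path_topology B) {x \<in> paths B. P x}"
  proof (rule open_prefix_set[of _ n])
    fix x assume "x \<in> {x \<in> paths B. P x}"
    then show "cylinder B n x \<subseteq> {x \<in> paths B. P x}"
      using assms[of x] unfolding cylinder_def by fastforce
  qed blast
  then have "openin X {x \<in> topspace X. \<phi> x \<in> {x \<in> paths B. P x}}"
    using homeomorphic_imp_continuous_map[OF phi_homeomorphic]
    by (rule openin_continuous_map_preimage[rotated])
  moreover have "{x \<in> topspace X. \<phi> x \<in> {x \<in> paths B. P x}} = {x \<in> space \<mu>. P (\<phi> x)}"
    using phi_path by (auto simp: space_eq)
  ultimately show ?thesis using openin_sets by simp
qed

text \<open>Floors of the tower over \<open>l\<close>, numbered from the top:
  \<open>level n l 0\<close> is the top floor and \<open>T\<close> lowers the number by one. With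
  this numbering the offsets between levels are given by suffixes.\<close>

definition level :: "nat \<Rightarrow> nat \<Rightarrow> nat \<Rightarrow> 'a set" where
  "level n l r = {x \<in> space \<mu>. path_vertex B n (\<phi> x) = l \<and> time_to_top n (\<phi> x) = r}"

lemma time_to_top_cong: "\<forall>i\<in>{1..n}. x i = y i \<Longrightarrow> time_to_top n x = time_to_top n y"
  by (auto simp: time_to_top_def intro!: sum.cong)

lemma level_sets: "n \<ge> 1 \<Longrightarrow> level n l r \<in> sets \<mu>"
  unfolding level_def
  by (rule prefix_sets[of n]) (auto simp: path_vertex_eq intro!: time_to_top_cong)

lemma level_vimage:
  assumes "n \<ge> 1" "Suc r < h n l"
  shows "T -` level n l r \<inter> space \<mu> = level n l (Suc r)"
  using vershik_map_level_iff[OF phi_path _ assms(1), of _ r l] phi_path T_space phi_T assms(2)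
  by (fastforce simp: level_def)

lemma level_agree:
  assumes "x \<in> level n l r" "y \<in> level n l r" "n \<ge> 1"
  shows "\<forall>i\<in>{1..n}. \<phi> x i = \<phi> y i"
  using assms time_to_top_inj[OF phi_path phi_path] by (auto simp: level_def)

text \<open>Floor \<open>Suc r\<close> is the preimage of floor \<open>r\<close>, so invariance of
  the measure gives them equal mass.\<close>

lemma measure_level:
  assumes "n \<ge> 1" "r < h n l"
  shows "measure \<mu> (level n l r) = measure \<mu> (level n l 0)"
  using assms(2)
proof (induction r)
  case (Suc r)
  have "measure \<mu> (level n l (Suc r)) = measure (distr \<mu> \<mu> T) (level n l r)"
    using level_vimage[OF assms(1) Suc.prems] level_sets[OF assms(1)] T_measurable
    by (subst measure_distr) auto
  then show ?case using Suc by (simp add: T_invariant)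
qed simp

text \<open>By invariance the integral over floor \<open>r\<close> is that of
  \<open>u \<circ> T\<close> over the floor beneath, where the eigenvalue equation pulls out one
  factor \<open>c\<close>.\<close>

lemma integral_level:
  fixes u :: "'a \<Rightarrow> complex"
  assumes "n \<ge> 1" "r < h n l" and u: "u \<in> borel_measurable \<mu>" "AE x in \<mu>. u (T x) = c * u x"
  shows "c ^ r * (LINT x:level n l r|\<mu>. u x) = (LINT x:level n l 0|\<mu>. u x)"
  using assms(2)
proof (induction r)
  case (Suc r)
  have "(LINT x:level n l r|\<mu>. u x) = (LINT x:level n l r|distr \<mu> \<mu> T. u x)"
    by (simp add: T_invariant)
  also have "\<dots> = (\<integral>x. indicator (level n l r) (T x) *\<^sub>R u (T x) \<partial>\<mu>)"
    unfolding set_lebesgue_integral_def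
    using level_sets[OF assms(1)] T_measurable u(1)
    by (intro integral_distr) (auto intro!: borel_measurable_scaleR)
  also have "\<dots> = (\<integral>x. c * (indicator (level n l (Suc r)) x *\<^sub>R u x) \<partial>\<mu>)"
  proof (rule integral_cong_AE)
    show "(\<lambda>x. indicator (level n l r) (T x) *\<^sub>R u (T x)) \<in> borel_measurable \<mu>"
      using level_sets[OF assms(1)] u(1) by (intro measurable_compose[OF T_measurable]) auto
    show "(\<lambda>x. c * (indicator (level n l (Suc r)) x *\<^sub>R u x)) \<in> borel_measurable \<mu>"
      using level_sets[OF assms(1)] u(1) by auto
    show "AE x in \<mu>. indicator (level n l r) (T x) *\<^sub>R u (T x) = c * (indicator (level n l (Suc r)) x *\<^sub>R u x)"
      using u(2) AE_space
    proof eventually_elim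
      case (elim x)
      then show ?case
        using level_vimage[OF assms(1) Suc.prems] by (auto simp: indicator_def)
    qed
  qed
  also have "\<dots> = c * (LINT x:level n l (Suc r)|\<mu>. u x)"
    by (simp add: set_lebesgue_integral_def del: mult_scaleR_right)
  finally show ?case using Suc by (simp add: mult_ac)
qed simp

lemma tower_eq: "n \<ge> 1 \<Longrightarrow> {x \<in> space \<mu>. path_vertex B n (\<phi> x) = l} = (\<Union>r<h n l. level n l r)"
  using time_to_top_less[OF phi_path] by (auto simp: level_def)

lemma measure_tower:
  assumes "n \<ge> 1"
  shows "measure \<mu> {x \<in> space \<mu>. path_vertex B n (\<phi> x) = l} = h n l * measure \<mu> (level n l 0)"
proof -
  have "measure \<mu> (\<Union>r<h n l. level n l r) = (\<Sum>r<h n l. measure \<mu> (level n l r))"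
    using level_sets[OF assms]
    by (intro finite_measure_finite_Union) (auto simp: disjoint_family_on_def level_def)
  also have "\<dots> = (\<Sum>r<h n l. measure \<mu> (level n l 0))"
    by (rule sum.cong[OF refl], rule measure_level[OF assms]) simp
  finally show ?thesis by (simp add: tower_eq[OF assms])
qed

text \<open>The points are covered by floors of the tower over \<open>k\<close>, one for each edge
  from \<open>l\<close> to \<open>k\<close> and each position in its block, all of equal mass. Read
  backwards, this bounds the mass of a single block from below, which accounts for the factor
  \<open>1 / M\<close> in the series.\<close>

lemma measure_two_levels_le:
  assumes "n \<ge> 1"
  shows "measure \<mu> {x \<in> space \<mu>. path_vertex B n (\<phi> x) = l \<and> path_vertex B (n + 1) (\<phi> x) = k}
    \<le> incidence B (n + 1) k l * (h n l * measure \<mu> (level (n + 1) k 0))"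
proof -
  let ?S = "{e \<in> E (Suc n). s (Suc n) e = l \<and> t (Suc n) e = k}"
  let ?I = "?S \<times> {..<h n l}"
  have fin: "finite ?I" using finite_edges[of "Suc n"] by simp
  have "{x \<in> space \<mu>. path_vertex B n (\<phi> x) = l \<and> path_vertex B (n + 1) (\<phi> x) = k}
    \<subseteq> (\<Union>(e, r)\<in>?I. level (Suc n) k (r + suffix_height n e))"
  proof
    fix x assume x: "x \<in> {x \<in> space \<mu>. path_vertex B n (\<phi> x) = l \<and> path_vertex B (n + 1) (\<phi> x) = k}"
    then have p: "\<phi> x \<in> paths B" using phi_path by simp
    have "(\<phi> x (Suc n), time_to_top n (\<phi> x)) \<in> ?I"
      using x path_edge[OF p, of "Suc n"] path_src[OF p assms] time_to_top_less[OF p assms] assms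
      by (auto simp: path_vertex_eq)
    moreover have "x \<in> level (Suc n) k (time_to_top n (\<phi> x) + suffix_height n (\<phi> x (Suc n)))"
      using x assms by (simp add: level_def time_to_top_Suc)
    ultimately show "x \<in> (\<Union>(e, r)\<in>?I. level (Suc n) k (r + suffix_height n e))" by blast
  qed
  then have "measure \<mu> {x \<in> space \<mu>. path_vertex B n (\<phi> x) = l \<and> path_vertex B (n + 1) (\<phi> x) = k}
      \<le> measure \<mu> (\<Union>(e, r)\<in>?I. level (Suc n) k (r + suffix_height n e))"
    using fin level_sets[of "Suc n"] by (intro finite_measure_mono) (auto intro!: sets.finite_UN)
  also have "\<dots> \<le> (\<Sum>(e, r)\<in>?I. measure \<mu> (level (Suc n) k (r + suffix_height n e)))"
    using fin level_sets[of "Suc n"]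
    by (simp add: case_prod_unfold) (intro finite_measure_subadditive_finite, auto)
  also have "\<dots> = (\<Sum>(e, r)\<in>?I. measure \<mu> (level (Suc n) k 0))"
  proof (rule sum.cong[OF refl], clarify)
    fix e r assume "r < h n (s (Suc n) e)" "e \<in> E (Suc n)"
    then show "measure \<mu> (level (Suc n) (t (Suc n) e) (r + suffix_height n e)) = measure \<mu> (level (Suc n) (t (Suc n) e) 0)"
      using suffix_height_le[OF assms, of e] by (intro measure_level) auto
  qed
  also have "\<dots> = incidence B (n + 1) k l * (h n l * measure \<mu> (level (n + 1) k 0))"
    by (simp add: case_prod_unfold incidence_def card_cartesian_product)
  finally show ?thesis .
qed

text \<open>The edge at level \<open>n + 1\<close> cuts the top floor into pieces, and the piece of
  \<open>e\<close> is the top of the block of \<open>e\<close> in the next tower.\<close>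

lemma level_refine:
  assumes "n \<ge> 1"
  shows "level n l 0 = (\<Union>e\<in>{e \<in> E (Suc n). s (Suc n) e = l}. level (Suc n) (t (Suc n) e) (suffix_height n e))"
  (is "_ = (\<Union>e\<in>?S. ?L e)")
proof -
  have L: "x \<in> ?L e \<longleftrightarrow> x \<in> space \<mu> \<and> \<phi> x (Suc n) = e \<and> time_to_top n (\<phi> x) = 0" if "e \<in> ?S" for e x
    using level_refine_iff[OF phi_path assms, of x e] that by (auto simp: level_def)
  have "x \<in> level n l 0 \<longleftrightarrow> x \<in> space \<mu> \<and> \<phi> x (Suc n) \<in> ?S \<and> time_to_top n (\<phi> x) = 0" for x
    using path_edge[OF phi_path, of x "Suc n"] path_src[OF phi_path assms, of x] assms
    by (auto simp: level_def path_vertex_eq)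
  with L show ?thesis by fastforce
qed

lemma disjoint_level_refine:
  assumes "n \<ge> 1"
  shows "disjoint_family_on (\<lambda>e. level (Suc n) (t (Suc n) e) (suffix_height n e)) (E (Suc n))"
  unfolding disjoint_family_on_def
proof (intro ballI impI equals0I)
  fix e f x assume "e \<in> E (Suc n)" "f \<in> E (Suc n)" "e \<noteq> f"
    and "x \<in> level (Suc n) (t (Suc n) e) (suffix_height n e) \<inter> level (Suc n) (t (Suc n) f) (suffix_height n f)"
  then show False
    using level_refine_iff[OF phi_path assms, of x e] level_refine_iff[OF phi_path assms, of x f]
    by (auto simp: level_def)
qed

lemma measure_level_refine:
  assumes "n \<ge> 1"
  shows "measure \<mu> (level n l 0) =
    (\<Sum>e\<in>{e \<in> E (Suc n). s (Suc n) e = l}. measure \<mu> (level (Suc n) (t (Suc n) e) 0))"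
proof -
  have "suffix_height n e < h (Suc n) (t (Suc n) e)" if "e \<in> E (Suc n)" for e
    using suffix_height_le[OF assms that] height_pos[OF assms src_vertex[OF assms that]] by simp
  then have "(\<Sum>e\<in>{e \<in> E (Suc n). s (Suc n) e = l}. measure \<mu> (level (Suc n) (t (Suc n) e) 0)) =
      (\<Sum>e\<in>{e \<in> E (Suc n). s (Suc n) e = l}. measure \<mu> (level (Suc n) (t (Suc n) e) (suffix_height n e)))"
    using measure_level[of "Suc n"] by (intro sum.cong) auto
  then show ?thesis
    unfolding level_refine[OF assms]
    using finite_edges[of "Suc n"] level_sets[of "Suc n"] disjoint_level_refine[OF assms]
    by (subst finite_measure_finite_Union) (auto intro: disjoint_family_on_mono[rotated])
qed

text \<open>Each piece of the refined floor is \<open>suffix_height n e\<close> steps away from the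
  top of its new tower. Moving its integral there costs that power of \<open>c\<close>, inverted by
  conjugation as \<open>c\<close> is unimodular.\<close>

lemma integral_level_refine:
  fixes u :: "'a \<Rightarrow> complex"
  assumes "n \<ge> 1" and u: "integrable \<mu> u" "AE x in \<mu>. u (T x) = c * u x" and c: "cmod c = 1"
  shows "(LINT x:level n l 0|\<mu>. u x) =
    (\<Sum>e\<in>{e \<in> E (Suc n). s (Suc n) e = l}.
      cnj (c ^ suffix_height n e) * (LINT x:level (Suc n) (t (Suc n) e) 0|\<mu>. u x))"
proof -
  have r: "suffix_height n e < h (Suc n) (t (Suc n) e)" if "e \<in> E (Suc n)" for e
    using suffix_height_le[OF assms(1) that] height_pos[OF assms(1) src_vertex[OF assms(1) that]] by simp
  have "(LINT x:level (Suc n) (t (Suc n) e) (suffix_height n e)|\<mu>. u x) =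
      cnj (c ^ suffix_height n e) * (LINT x:level (Suc n) (t (Suc n) e) 0|\<mu>. u x)" if "e \<in> E (Suc n)" for e
  proof -
    have "cnj (c ^ k) * c ^ k = 1" for k
      using c complex_norm_square[of "c ^ k"] by (simp add: norm_power mult.commute)
    then show ?thesis
      using integral_level[OF _ r[OF that] _ u(2)] u(1)
      by (metis borel_measurable_integrable le_add1 mult.assoc mult_1 plus_1_eq_Suc)
  qed
  then show ?thesis
    unfolding level_refine[OF assms(1)]
    using finite_edges[of "Suc n"] level_sets[of "Suc n"] disjoint_level_refine[OF assms(1)] u(1)
    by (subst set_integral_finite_Union)
      (auto intro: disjoint_family_on_mono[rotated] integrable_mult_indicator simp: set_integrable_def)
qed

section \<open>Approximation by functions of finitely many edges\<close>


definition level_function :: "nat \<Rightarrow> ('a \<Rightarrow> complex) \<Rightarrow> bool" where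
  "level_function n g \<longleftrightarrow>
    (\<forall>x\<in>space \<mu>. \<forall>y\<in>space \<mu>. (\<forall>i\<in>{1..n}. \<phi> x i = \<phi> y i) \<longrightarrow> g x = g y)"

text \<open>Membership in the \<open>L\<^sup>1\<close> closure of the functions of finitely many
  edges. That every integrable function belongs to it does the work of convergence of the
  conditional expectations.\<close>

definition level_approximable :: "('a \<Rightarrow> complex) \<Rightarrow> bool" where
  "level_approximable f \<longleftrightarrow>
    (\<forall>\<epsilon>>0. \<exists>n g. integrable \<mu> g \<and> level_function n g \<and> (\<integral>x. cmod (f x - g x) \<partial>\<mu>) < \<epsilon>)"

lemma level_function_mono: "m \<le> n \<Longrightarrow> level_function m g \<Longrightarrow> level_function n g"
  unfolding level_function_def by (meson atLeastAtMost_iff order_trans)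

lemma level_approximable_level_function:
  "integrable \<mu> g \<Longrightarrow> level_function n g \<Longrightarrow> level_approximable g"
  unfolding level_approximable_def by force

lemma level_approximable_limit:
  assumes f: "integrable \<mu> f"
    and ap: "\<And>\<epsilon>. \<epsilon> > 0 \<Longrightarrow> \<exists>f'. integrable \<mu> f' \<and> level_approximable f' \<and> (\<integral>x. cmod (f x - f' x) \<partial>\<mu>) < \<epsilon>"
  shows "level_approximable f"
  unfolding level_approximable_def
proof (intro allI impI)
  fix \<epsilon> :: real assume "\<epsilon> > 0"
  then obtain f' where f': "integrable \<mu> f'" "level_approximable f'" "(\<integral>x. cmod (f x - f' x) \<partial>\<mu>) < \<epsilon> / 2"
    using ap[of "\<epsilon> / 2"] by auto
  then obtain n g where g: "integrable \<mu> g" "level_function n g" "(\<integral>x. cmod (f' x - g x) \<partial>\<mu>) < \<epsilon> / 2"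
    using \<open>\<epsilon> > 0\<close> unfolding level_approximable_def by (metis half_gt_zero)
  have "(\<integral>x. cmod (f x - g x) \<partial>\<mu>) \<le> (\<integral>x. cmod (f x - f' x) + cmod (f' x - g x) \<partial>\<mu>)"
    using f f'(1) g(1) norm_triangle_ineq[of "f x - f' x" "f' x - g x" for x]
    by (intro integral_mono) auto
  also have "\<dots> = (\<integral>x. cmod (f x - f' x) \<partial>\<mu>) + (\<integral>x. cmod (f' x - g x) \<partial>\<mu>)"
    using f f'(1) g(1) by (intro Bochner_Integration.integral_add) auto
  finally show "\<exists>n g. integrable \<mu> g \<and> level_function n g \<and> (\<integral>x. cmod (f x - g x) \<partial>\<mu>) < \<epsilon>"
    using f'(3) g by (intro exI[of _ n] exI[of _ g]) auto
qed

lemma level_approximable_add: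
  assumes "integrable \<mu> f1" "level_approximable f1" "integrable \<mu> f2" "level_approximable f2"
  shows "level_approximable (\<lambda>x. f1 x + f2 x)"
  unfolding level_approximable_def
proof (intro allI impI)
  fix \<epsilon> :: real assume "\<epsilon> > 0"
  then have "\<epsilon> / 2 > 0" by simp
  then obtain n g m g' where g: "integrable \<mu> g" "level_function n g" "(\<integral>x. cmod (f1 x - g x) \<partial>\<mu>) < \<epsilon> / 2"
    and g': "integrable \<mu> g'" "level_function m g'" "(\<integral>x. cmod (f2 x - g' x) \<partial>\<mu>) < \<epsilon> / 2"
    using assms(2,4) unfolding level_approximable_def by meson
  have "level_function (max m n) (\<lambda>x. g x + g' x)"
    using level_function_mono[of n "max m n" g] level_function_mono[of m "max m n" g'] g g'
    unfolding level_function_def by (metis max.cobounded1 max.cobounded2)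
  moreover have "(\<integral>x. cmod (f1 x + f2 x - (g x + g' x)) \<partial>\<mu>) \<le> (\<integral>x. cmod (f1 x - g x) + cmod (f2 x - g' x) \<partial>\<mu>)"
    using assms(1,3) g(1) g'(1) norm_diff_triangle_ineq by (intro integral_mono) auto
  moreover have "\<dots> = (\<integral>x. cmod (f1 x - g x) \<partial>\<mu>) + (\<integral>x. cmod (f2 x - g' x) \<partial>\<mu>)"
    using assms(1,3) g(1) g'(1) by (intro Bochner_Integration.integral_add) auto
  ultimately show "\<exists>n g. integrable \<mu> g \<and> level_function n g \<and> (\<integral>x. cmod (f1 x + f2 x - g x) \<partial>\<mu>) < \<epsilon>"
    using g g' by (intro exI[of _ "max m n"] exI[of _ "\<lambda>x. g x + g' x"]) auto
qed

lemma level_approximable_mult: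
  assumes "level_approximable f"
  shows "level_approximable (\<lambda>x. f x * a)"
  unfolding level_approximable_def
proof (intro allI impI)
  fix \<epsilon> :: real assume "\<epsilon> > 0"
  \<comment> \<open>The added 1 keeps the denominator positive when \<open>a = 0\<close>.\<close>
  then have "\<epsilon> / (cmod a + 1) > 0" by (intro divide_pos_pos) (simp_all add: add_nonneg_pos)
  then obtain n g where g: "integrable \<mu> g" "level_function n g" "(\<integral>x. cmod (f x - g x) \<partial>\<mu>) < \<epsilon> / (cmod a + 1)"
    using assms unfolding level_approximable_def by meson
  have "(\<integral>x. cmod (f x * a - g x * a) \<partial>\<mu>) = (\<integral>x. cmod (f x - g x) \<partial>\<mu>) * cmod a"
    by (simp flip: left_diff_distrib add: norm_mult)
  also have "\<dots> \<le> (\<integral>x. cmod (f x - g x) \<partial>\<mu>) * (cmod a + 1)"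
    by (intro mult_left_mono) auto
  also have "\<dots> < \<epsilon>"
    using g(3) by (simp add: pos_less_divide_eq add_nonneg_pos)
  finally show "\<exists>n g. integrable \<mu> g \<and> level_function n g \<and> (\<integral>x. cmod (f x * a - g x) \<partial>\<mu>) < \<epsilon>"
  proof (intro exI[of _ n] exI[of _ "\<lambda>x. g x * a"] conjI)
    show "level_function n (\<lambda>x. g x * a)"
      using g(2) unfolding level_function_def by metis
  qed (use g(1) in auto)
qed

lemma level_approximable_cong:
  assumes "\<And>x. x \<in> space \<mu> \<Longrightarrow> f x = f' x" "level_approximable f"
  shows "level_approximable f'"
proof -
  have "(\<integral>x. cmod (f x - g x) \<partial>\<mu>) = (\<integral>x. cmod (f' x - g x) \<partial>\<mu>)" for g
    using assms(1) by (intro Bochner_Integration.integral_cong) auto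
  then show ?thesis using assms(2) unfolding level_approximable_def by simp
qed

lemma integrable_complex_indicator: "A \<in> sets \<mu> \<Longrightarrow> integrable \<mu> (indicator A :: 'a \<Rightarrow> complex)"
  using integrable_of_real[OF integrable_real_indicator[of A \<mu>], where ?'a = complex]
  by (simp add: emeasure_eq_measure of_real_indicator cong: integrable_cong)

text \<open>Continuity of the measure from below makes the indicators converge in
  \<open>L\<^sup>1\<close>.\<close>

lemma level_approximable_incseq:
  assumes A: "incseq A" "\<And>i::nat. A i \<in> sets \<mu>" "\<And>i. level_approximable (indicator (A i))"
  shows "level_approximable (indicator (\<Union>i. A i))"
proof (rule level_approximable_limit)
  have U: "(\<Union>i. A i) \<in> sets \<mu>" using A(2) by blast
  then show "integrable \<mu> (indicator (\<Union>i. A i) :: 'a \<Rightarrow> complex)"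
    by (rule integrable_complex_indicator)
  fix \<epsilon> :: real assume "\<epsilon> > 0"
  have "(\<lambda>i. measure \<mu> (A i)) \<longlonglongrightarrow> measure \<mu> (\<Union>i. A i)"
    using A by (intro finite_Lim_measure_incseq) auto
  then obtain i where i: "\<bar>measure \<mu> (A i) - measure \<mu> (\<Union>i. A i)\<bar> < \<epsilon>"
    using \<open>\<epsilon> > 0\<close> unfolding LIMSEQ_def dist_real_def by blast
  have "cmod (indicator (\<Union>i. A i) x - indicator (A i) x) = indicator ((\<Union>i. A i) - A i) x" for x
    by (auto simp: indicator_def)
  then have "(\<integral>x. cmod (indicator (\<Union>i. A i) x - indicator (A i) x) \<partial>\<mu>) = measure \<mu> ((\<Union>i. A i) - A i)"
    using U A(2) by simp
  also have "\<dots> = measure \<mu> (\<Union>i. A i) - measure \<mu> (A i)"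
    using U A(2) by (intro finite_measure_Diff) auto
  finally have "(\<integral>x. cmod (indicator (\<Union>i. A i) x - indicator (A i) x) \<partial>\<mu>) < \<epsilon>"
    using i by simp
  then show "\<exists>f'. integrable \<mu> f' \<and> level_approximable f' \<and> (\<integral>x. cmod (indicator (\<Union>i. A i) x - f' x) \<partial>\<mu>) < \<epsilon>"
    using A integrable_complex_indicator by blast
qed

lemma level_approximable_open:
  assumes "openin X U"
  shows "level_approximable (indicator U)"
proof -
  have V: "openin (path_topology B) (\<phi> ` U)"
    using homeomorphic_imp_open_map[OF phi_homeomorphic] assms by (simp add: open_map_def)
  have sub: "U \<subseteq> space \<mu>" using openin_subset[OF assms] by (simp add: space_eq)
  have inj: "inj_on \<phi> (space \<mu>)"
    using homeomorphic_imp_injective_map[OF phi_homeomorphic] by (simp add: space_eq)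
  \<comment> \<open>\<open>A n\<close> is the union of the level-\<open>n\<close> cylinders inside
    \<open>U\<close>; these sets increase to \<open>U\<close> because \<open>U\<close> is
    open.\<close>
  define A where "A n = {x \<in> space \<mu>. cylinder B n (\<phi> x) \<subseteq> \<phi> ` U}" for n
  have "incseq A"
    using cylinder_mono unfolding A_def incseq_def by blast
  moreover have sets: "A n \<in> sets \<mu>" for n
    unfolding A_def by (rule prefix_sets[of n]) (auto simp: cylinder_def)
  moreover have "level_function n (indicator (A n))" for n
    unfolding level_function_def A_def by (auto simp: indicator_def cylinder_def)
  then have "level_approximable (indicator (A n))" for n
    using sets integrable_complex_indicator level_approximable_level_function by blast
  ultimately have "level_approximable (indicator (\<Union>n. A n))"
    by (rule level_approximable_incseq)
  moreover have "(\<Union>n. A n) = U"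
  proof
    show "(\<Union>n. A n) \<subseteq> U"
    proof
      fix x assume "x \<in> (\<Union>n. A n)"
      then have "x \<in> space \<mu>" "\<phi> x \<in> \<phi> ` U"
        using cylinder_self phi_path unfolding A_def by blast+
      then show "x \<in> U" using inj sub by (auto dest: inj_onD)
    qed
    show "U \<subseteq> (\<Union>n. A n)"
    proof
      fix x assume "x \<in> U"
      then obtain n where "cylinder B n (\<phi> x) \<subseteq> \<phi> ` U"
        using open_contains_cylinder[OF V] by blast
      then show "x \<in> (\<Union>n. A n)" using sub \<open>x \<in> U\<close> by (auto simp: A_def)
    qed
  qed
  ultimately show ?thesis by simp
qed

text \<open>Dynkin's argument from the open sets, an intersection-stable generator of the Borel
  sets.\<close>

lemma level_approximable_sets:
  assumes "A \<in> sets \<mu>"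
  shows "level_approximable (indicator A)"
proof -
  have gen: "sets \<mu> = sigma_sets (topspace X) {U. openin X U}"
    using borel by (simp add: borel_prob_measure_def)
  have "Int_stable {U. openin X U}" by (auto simp: Int_stable_def)
  moreover have "{U. openin X U} \<subseteq> Pow (topspace X)" using openin_subset by blast
  moreover have "A \<in> sigma_sets (topspace X) {U. openin X U}" using assms gen by simp
  ultimately show ?thesis
  proof (induction rule: sigma_sets_induct_disjoint)
    case (basic A)
    then show ?case using level_approximable_open by simp
  next
    case empty
    then show ?case using level_approximable_open[OF openin_empty] .
  next
    case (compl A)
    have "A \<in> sets \<mu>" using compl gen by simp
    have "level_approximable (indicator (space \<mu>))"
      using level_approximable_open[of "topspace X"] by (simp add: space_eq)
    then have "level_approximable (\<lambda>x. indicator (space \<mu>) x + indicator A x * (-1))"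
      using compl \<open>A \<in> sets \<mu>\<close> integrable_complex_indicator
      by (intro level_approximable_add level_approximable_mult) auto
    then show ?case
      by (rule level_approximable_cong[rotated]) (auto simp: indicator_def space_eq)
  next
    case (union A)
    have A: "A i \<in> sets \<mu>" for i using union(2) gen by blast
    \<comment> \<open>Finite unions come first, where disjointness makes the indicators add; the
      countable union is their increasing limit.\<close>
    have ap: "level_approximable (indicator (\<Union>i<n. A i))" for n
    proof (induction n)
      case 0
      then show ?case
        using level_approximable_open[OF openin_empty] by (simp only: lessThan_0 image_empty Union_empty)
    next
      case (Suc n)
      have "level_approximable (\<lambda>x. indicator (\<Union>i<n. A i) x + indicator (A n) x)"
        using Suc union(3) A
        by (intro level_approximable_add integrable_complex_indicator) auto
      moreover have "(\<Union>i<n. A i) \<inter> A n = {}"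
        using disjoint_family_onD[OF union(1), of n] by fastforce
      then have "indicator (\<Union>i<n. A i) x + indicator (A n) x = (indicator (\<Union>i<Suc n. A i) x :: complex)" for x
        by (auto simp: indicator_def less_Suc_eq)
      ultimately show ?case by simp
    qed
    have "level_approximable (indicator (\<Union>n. \<Union>i<n. A i))"
      using A by (intro level_approximable_incseq ap) (auto 0 3 simp: incseq_def intro: less_le_trans)
    moreover have "(\<Union>n. \<Union>i<n. A i) = (\<Union>i. A i)" by auto
    ultimately show ?case by simp
  qed
qed

lemma level_approximable_integrable:
  fixes f :: "'a \<Rightarrow> complex"
  assumes "integrable \<mu> f"
  shows "level_approximable f"
  using assms
proof (induction rule: integrable_induct)
  case (base A a)
  then have "level_approximable (\<lambda>x. indicator A x * a)"
    by (intro level_approximable_mult level_approximable_sets)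
  then show ?case
    by (rule level_approximable_cong[rotated]) (auto simp: indicator_def)
next
  case (add f g)
  then show ?case by (intro level_approximable_add)
next
  case (lim f g)
  have "(\<lambda>i. \<integral>x. cmod (f x - g i x) \<partial>\<mu>) \<longlonglongrightarrow> (\<integral>x. 0 \<partial>\<mu>)"
  proof (rule integral_dominated_convergence)
    \<comment> \<open>The induction rule supplies approximants with modulus at most
      \<open>2 * cmod (f x)\<close>, so the difference is dominated by three times the
      modulus.\<close>
    show "integrable \<mu> (\<lambda>x. 3 * cmod (f x))"
      using integrable_norm[OF lim(4)] by simp
    show "AE x in \<mu>. (\<lambda>i. cmod (f x - g i x)) \<longlonglongrightarrow> 0"
    proof (rule AE_I2)
      fix x assume "x \<in> space \<mu>"
      then show "(\<lambda>i. cmod (f x - g i x)) \<longlonglongrightarrow> 0"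
        using tendsto_norm[OF tendsto_diff[OF tendsto_const lim(2)], of x "f x"] by simp
    qed
    show "AE x in \<mu>. norm (cmod (f x - g i x)) \<le> 3 * cmod (f x)" for i
    proof (rule AE_I2)
      fix x assume "x \<in> space \<mu>"
      then show "norm (cmod (f x - g i x)) \<le> 3 * cmod (f x)"
        using lim(3)[of x i] norm_triangle_ineq4[of "f x" "g i x"] by simp
    qed
  qed (use lim(1,4) in \<open>auto intro: borel_measurable_integrable\<close>)
  then have "\<exists>i. (\<integral>x. cmod (f x - g i x) \<partial>\<mu>) < \<epsilon>" if "\<epsilon> > 0" for \<epsilon>
    using order_tendstoD(2)[of _ 0 sequentially \<epsilon>] that by (auto simp: eventually_sequentially)
  then have "\<exists>f'. integrable \<mu> f' \<and> level_approximable f' \<and> (\<integral>x. cmod (f x - f' x) \<partial>\<mu>) < \<epsilon>"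
    if "\<epsilon> > 0" for \<epsilon>
    using that lim(1,5) by meson
  then show ?case by (rule level_approximable_limit[OF lim(4)])
qed

text \<open>\<open>g\<close> is constant on the floor, so its integral has modulus mass times
  \<open>cmod (g x0)\<close>. Comparing \<open>u\<close> with \<open>g\<close> twice, once for the
  integrals and once for the pointwise moduli, costs the error term twice.\<close>

lemma integral_level_lower:
  fixes u g :: "'a \<Rightarrow> complex"
  assumes u: "integrable \<mu> u" "AE x in \<mu>. cmod (u x) = 1"
    and g: "integrable \<mu> g" "level_function n g" and "n \<ge> 1"
  shows "measure \<mu> (level n l r) - 2 * (LINT x:level n l r|\<mu>. cmod (u x - g x)) \<le> cmod (LINT x:level n l r|\<mu>. u x)"
proof (cases "level n l r = {}")
  case True
  then show ?thesis by (simp add: set_lebesgue_integral_def)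
next
  case False
  let ?A = "level n l r"
  have A: "?A \<in> sets \<mu>" using level_sets assms(5) by simp
  obtain x0 where x0: "x0 \<in> ?A" using False by auto
  have ga: "g x = g x0" if "x \<in> ?A" for x
    using g(2) level_agree[OF that x0 assms(5)] that x0 unfolding level_function_def by (auto simp: level_def)
  have int: "set_integrable \<mu> ?A u" "set_integrable \<mu> ?A g" "set_integrable \<mu> ?A (\<lambda>x. cmod (u x - g x))"
    "set_integrable \<mu> ?A (\<lambda>x. cmod (g x))"
    unfolding set_integrable_def using A u(1) g(1)
    by (auto simp del: real_scaleR_def intro!: integrable_mult_indicator)
  have g_int: "(LINT x:?A|\<mu>. g x) = measure \<mu> ?A * g x0"
  proof -
    have "(LINT x:?A|\<mu>. g x) = (LINT x:?A|\<mu>. g x0)"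
      using ga A by (intro set_lebesgue_integral_cong) auto
    then show ?thesis using A by (simp add: set_lebesgue_integral_def scaleR_conv_of_real)
  qed
  have "measure \<mu> ?A * cmod (g x0) = cmod (LINT x:?A|\<mu>. g x)"
    by (simp add: g_int norm_mult)
  also have "\<dots> \<le> cmod (LINT x:?A|\<mu>. u x) + cmod (LINT x:?A|\<mu>. u x - g x)"
    using int norm_triangle_sub[of "LINT x:?A|\<mu>. g x" "LINT x:?A|\<mu>. u x"]
    by (simp add: set_integral_diff norm_minus_commute)
  also have "cmod (LINT x:?A|\<mu>. u x - g x) \<le> (LINT x:?A|\<mu>. cmod (u x - g x))"
    using int by (intro set_integral_norm_bound set_integral_diff)
  finally have 1: "measure \<mu> ?A * cmod (g x0) \<le> cmod (LINT x:?A|\<mu>. u x) + (LINT x:?A|\<mu>. cmod (u x - g x))"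
    by simp
  have "measure \<mu> ?A = (LINT x:?A|\<mu>. 1)"
    using A by (simp add: set_lebesgue_integral_def)
  also have "\<dots> \<le> (LINT x:?A|\<mu>. cmod (u x - g x) + cmod (g x0))"
    unfolding set_lebesgue_integral_def
  proof (rule integral_mono_AE)
    show "integrable \<mu> (\<lambda>x. indicator ?A x *\<^sub>R (1::real))"
      using A by (auto simp: emeasure_eq_measure)
    show "integrable \<mu> (\<lambda>x. indicator ?A x *\<^sub>R (cmod (u x - g x) + cmod (g x0)))"
      using A u(1) g(1) by (intro integrable_mult_indicator) auto
    show "AE x in \<mu>. indicator ?A x *\<^sub>R 1 \<le> indicator ?A x *\<^sub>R (cmod (u x - g x) + cmod (g x0))"
      using u(2)
    proof eventually_elim
      case (elim x)
      then show ?case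
        using ga[of x] norm_triangle_sub[of "u x" "g x"] by (auto simp: indicator_def)
    qed
  qed
  also have "\<dots> = (LINT x:?A|\<mu>. cmod (u x - g x)) + (LINT x:?A|\<mu>. cmod (g x0))"
    using A int(3) by (intro set_integral_add) (auto simp: set_integrable_def emeasure_eq_measure)
  also have "(LINT x:?A|\<mu>. cmod (g x0)) = measure \<mu> ?A * cmod (g x0)"
    using A by (simp add: set_lebesgue_integral_def)
  finally show ?thesis using 1 by simp
qed

text \<open>A unimodular eigenfunction is close in \<open>L\<^sup>1\<close> to a function of the first \<open>n\<close> edges, which is
  constant on each floor, so on towers that are not too small averaging loses little modulus.\<close>

lemma average_lower_bound:
  fixes u :: "'a \<Rightarrow> complex"
  assumes u: "integrable \<mu> u" "AE x in \<mu>. cmod (u x) = 1" "AE x in \<mu>. u (T x) = c * u x"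
    and c: "cmod c = 1" and "\<delta> > 0"
  shows "\<exists>N\<ge>1. \<forall>n\<ge>N. \<forall>l. \<delta> \<le> measure \<mu> {x \<in> space \<mu>. path_vertex B n (\<phi> x) = l} \<longrightarrow>
    measure \<mu> (level n l 0) \<le> 2 * cmod (LINT x:level n l 0|\<mu>. u x)"
proof -
  \<comment> \<open>With \<open>\<delta> / 4\<close>, twice the error over a tower of mass at least
    \<open>\<delta>\<close> is less than half of that mass, which leaves the factor 2 in the
    conclusion.\<close>
  obtain N g where g: "integrable \<mu> g" "level_function N g" "(\<integral>x. cmod (u x - g x) \<partial>\<mu>) < \<delta> / 4"
    using level_approximable_integrable[OF u(1)] \<open>\<delta> > 0\<close> unfolding level_approximable_def
    by (metis zero_less_divide_iff zero_less_numeral)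
  have "measure \<mu> (level n l 0) \<le> 2 * cmod (LINT x:level n l 0|\<mu>. u x)"
    if n: "n \<ge> max 1 N" and l: "\<delta> \<le> measure \<mu> {x \<in> space \<mu>. path_vertex B n (\<phi> x) = l}" for n l
  proof -
    have n1: "n \<ge> 1" and gn: "level_function n g" using n level_function_mono g(2) by auto
    let ?F = "cmod (LINT x:level n l 0|\<mu>. u x)" and ?D = "\<lambda>r. LINT x:level n l r|\<mu>. cmod (u x - g x)"
    \<comment> \<open>Since \<open>c\<close> is unimodular, all floors of the tower have integrals
      of the same modulus.\<close>
    have F: "cmod (LINT x:level n l r|\<mu>. u x) = ?F" if "r < h n l" for r
      using integral_level[OF n1 that _ u(3)] u(1) c by (metis borel_measurable_integrable mult_1 norm_mult norm_power power_one)
    have "set_integrable \<mu> (level n l r) (\<lambda>x. cmod (u x - g x))" for r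
      unfolding set_integrable_def using level_sets[OF n1] u(1) g(1)
      by (intro integrable_mult_indicator) auto
    moreover have "disjoint_family_on (level n l) {..<h n l}"
      by (auto simp: disjoint_family_on_def level_def)
    ultimately have "(\<Sum>r<h n l. ?D r) = (LINT x:(\<Union>r<h n l. level n l r)|\<mu>. cmod (u x - g x))"
      using level_sets[OF n1] by (intro set_integral_finite_Union[symmetric]) auto
    also have "\<dots> \<le> (\<integral>x. cmod (u x - g x) \<partial>\<mu>)"
      unfolding set_lebesgue_integral_def using level_sets[OF n1] u(1) g(1)
      by (intro integral_mono integrable_mult_indicator) (auto simp: indicator_def)
    finally have D: "(\<Sum>r<h n l. ?D r) < \<delta> / 4" using g(3) by simp
    have "h n l * measure \<mu> (level n l 0) - 2 * (\<Sum>r<h n l. ?D r) = (\<Sum>r<h n l. measure \<mu> (level n l 0) - 2 * ?D r)"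
      by (simp add: sum_subtractf sum_distrib_left)
    also have "\<dots> \<le> (\<Sum>r<h n l. ?F)"
    proof (rule sum_mono)
      fix r assume "r \<in> {..<h n l}"
      then show "measure \<mu> (level n l 0) - 2 * ?D r \<le> ?F"
        using integral_level_lower[OF u(1,2) g(1) gn n1, of l r] F[of r] measure_level[OF n1, of r l] by simp
    qed
    finally have *: "h n l * measure \<mu> (level n l 0) - 2 * (\<Sum>r<h n l. ?D r) \<le> h n l * ?F" by simp
    have "\<delta> \<le> h n l * measure \<mu> (level n l 0)" using l measure_tower[OF n1] by simp
    then have "h n l * measure \<mu> (level n l 0) \<le> h n l * (2 * ?F)" "h n l > 0"
      using * D \<open>\<delta> > 0\<close> by (auto intro!: gr0I)
    then show ?thesis by simp
  qed
  then show ?thesis by (intro exI[of _ "max 1 N"]) auto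
qed

section \<open>Martingale increments\<close>


abbreviation "base_mass n l \<equiv> measure \<mu> (level n l 0)"

text \<open>The number \<open>C\<^sub>n(l)\<close>, the value on the top floor of the conditional
  expectation given the first \<open>n\<close> edges. On a null floor, division by zero makes it
  0.\<close>

definition base_average :: "('a \<Rightarrow> complex) \<Rightarrow> nat \<Rightarrow> nat \<Rightarrow> complex" where
  "base_average u n l = (LINT x:level n l 0|\<mu>. u x) / base_mass n l"

text \<open>The squared norm in \<open>L\<^sup>2\<close> of the conditional expectation of \<open>u\<close> given the first
  \<open>n\<close> edges.\<close>

definition energy :: "('a \<Rightarrow> complex) \<Rightarrow> nat \<Rightarrow> real" where
  "energy u n = (\<Sum>l\<in>{1..d}. h n l * (base_mass n l * (cmod (base_average u n l))\<^sup>2))"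

lemma norm_integral_le_base_mass:
  fixes u :: "'a \<Rightarrow> complex"
  assumes "integrable \<mu> u" "AE x in \<mu>. cmod (u x) = 1" "n \<ge> 1"
  shows "cmod (LINT x:level n l 0|\<mu>. u x) \<le> base_mass n l"
proof -
  have A: "level n l 0 \<in> sets \<mu>" using level_sets[OF assms(3)] .
  have "cmod (LINT x:level n l 0|\<mu>. u x) \<le> (\<integral>x. cmod (indicator (level n l 0) x *\<^sub>R u x) \<partial>\<mu>)"
    unfolding set_lebesgue_integral_def by (rule integral_norm_bound)
  also have "\<dots> = (\<integral>x. indicator (level n l 0) x \<partial>\<mu>)"
  proof (rule integral_cong_AE)
    show "AE x in \<mu>. cmod (indicator (level n l 0) x *\<^sub>R u x) = indicator (level n l 0) x"
      using assms(2) by eventually_elim (simp add: indicator_def)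
  qed (use assms(1) A in auto)
  finally show ?thesis using A by simp
qed

text \<open>On a null floor both sides vanish, because the mass bounds the integral.\<close>

lemma base_average_times_mass:
  assumes "integrable \<mu> u" "AE x in \<mu>. cmod (u x) = 1" "n \<ge> 1"
  shows "base_mass n l * base_average u n l = (LINT x:level n l 0|\<mu>. u x)"
  using norm_integral_le_base_mass[OF assms, of l] by (auto simp: base_average_def)

text \<open>Each of the \<open>d\<close> terms is the mass of a tower times a squared modulus at
  most 1; this crude bound is enough for summability.\<close>

lemma energy_le:
  assumes "integrable \<mu> u" "AE x in \<mu>. cmod (u x) = 1" "n \<ge> 1"
  shows "energy u n \<le> d"
proof -
  have "h n l * (base_mass n l * (cmod (base_average u n l))\<^sup>2) \<le> 1" for l
  proof -
    have "cmod (base_average u n l) \<le> 1"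
      using norm_integral_le_base_mass[OF assms, of l]
      by (auto simp: base_average_def norm_divide divide_le_eq_1 less_le)
    then have "(cmod (base_average u n l))\<^sup>2 \<le> 1" by (simp add: power_le_one)
    then have "(h n l * base_mass n l) * (cmod (base_average u n l))\<^sup>2 \<le> 1 * 1"
      using measure_tower[OF assms(3), of l] prob_le_1[of "{x \<in> space \<mu>. path_vertex B n (\<phi> x) = l}"]
      by (intro mult_mono) auto
    then show ?thesis by (simp add: mult.assoc)
  qed
  then show ?thesis
    unfolding energy_def using sum_mono[of "{1..d}" _ "\<lambda>_. 1::real"] by fastforce
qed

lemma sum_by_src:
  fixes f :: "'e \<Rightarrow> 'b::comm_monoid_add"
  assumes "n \<ge> 1"
  shows "(\<Sum>e\<in>E (Suc n). f e) = (\<Sum>l\<in>{1..d}. \<Sum>e\<in>{e \<in> E (Suc n). s (Suc n) e = l}. f e)"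
  using assms src_vertex finite_edges[of "Suc n"] by (intro sum.group[symmetric]) auto

lemma sum_by_tgt:
  fixes f :: "'e \<Rightarrow> 'b::comm_monoid_add"
  assumes "n \<ge> 1"
  shows "(\<Sum>e\<in>E (Suc n). f e) = (\<Sum>l\<in>{1..d}. \<Sum>e\<in>{e \<in> E (Suc n). t (Suc n) e = l}. f e)"
  using assms tgt_vertex[of "Suc n"] finite_edges[of "Suc n"] by (intro sum.group[symmetric]) auto

text \<open>Orthogonality of martingale increments.\<close>

lemma energy_increment:
  fixes u :: "'a \<Rightarrow> complex"
  assumes n: "n \<ge> 1" and u: "integrable \<mu> u" "AE x in \<mu>. cmod (u x) = 1" "AE x in \<mu>. u (T x) = c * u x"
    and c: "cmod c = 1"
  shows "(\<Sum>e\<in>E (Suc n). h n (s (Suc n) e) * base_mass (Suc n) (t (Suc n) e) *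
      (cmod (cnj (c ^ suffix_height n e) * base_average u (Suc n) (t (Suc n) e) - base_average u n (s (Suc n) e)))\<^sup>2)
    = energy u (Suc n) - energy u n"
proof -
  let ?E = "E (Suc n)" and ?s = "s (Suc n)" and ?t = "t (Suc n)"
  let ?C = "base_average u n" and ?C' = "base_average u (Suc n)"
  let ?m' = "base_mass (Suc n)"
  let ?w = "\<lambda>e. cnj (c ^ suffix_height n e)"
  have w: "cmod (?w e) = 1" for e using c by (simp add: norm_power)
  have expand: "(cmod (a - b))\<^sup>2 = (cmod a)\<^sup>2 + (cmod b)\<^sup>2 - 2 * Re (a * cnj b)" for a b :: complex
    unfolding cmod_power2 by (simp add: power2_eq_square algebra_simps)
  \<comment> \<open>Grouped by end-point: the heights of the blocks into \<open>k\<close> add up to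
    the height of the new tower.\<close>
  have S1: "(\<Sum>e\<in>?E. h n (?s e) * ?m' (?t e) * (cmod (?C' (?t e)))\<^sup>2) = energy u (Suc n)"
  proof -
    have "(\<Sum>e\<in>?E. h n (?s e) * ?m' (?t e) * (cmod (?C' (?t e)))\<^sup>2) =
      (\<Sum>k\<in>{1..d}. \<Sum>e\<in>{e \<in> ?E. ?t e = k}. h n (?s e) * (?m' k * (cmod (?C' k))\<^sup>2))"
      unfolding sum_by_tgt[OF n] by (intro sum.cong) auto
    also have "\<dots> = energy u (Suc n)"
      unfolding energy_def using height_Suc[OF n] by (intro sum.cong) (simp_all add: sum_distrib_right)
    finally show ?thesis .
  qed
  \<comment> \<open>Grouped by initial point: the pieces of the old top floor add up to its
    mass.\<close>
  have S2: "(\<Sum>e\<in>?E. h n (?s e) * ?m' (?t e) * (cmod (?C (?s e)))\<^sup>2) = energy u n"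
  proof -
    have "(\<Sum>e\<in>?E. h n (?s e) * ?m' (?t e) * (cmod (?C (?s e)))\<^sup>2) =
      (\<Sum>l\<in>{1..d}. \<Sum>e\<in>{e \<in> ?E. ?s e = l}. h n l * (cmod (?C l))\<^sup>2 * ?m' (?t e))"
      unfolding sum_by_src[OF n] by (intro sum.cong) auto
    also have "\<dots> = energy u n"
      unfolding energy_def using measure_level_refine[OF n]
      by (intro sum.cong) (simp_all flip: sum_distrib_left)
    finally show ?thesis .
  qed
  \<comment> \<open>The martingale property: the new averages, with phases and masses, sum to the
    old integral over the top floor. So the cross term is again the old energy.\<close>
  have S3: "(\<Sum>e\<in>?E. h n (?s e) * ?m' (?t e) * Re (?w e * ?C' (?t e) * cnj (?C (?s e)))) = energy u n"
  proof -
    have "(\<Sum>e\<in>?E. h n (?s e) * ?m' (?t e) * Re (?w e * ?C' (?t e) * cnj (?C (?s e)))) =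
      (\<Sum>l\<in>{1..d}. \<Sum>e\<in>{e \<in> ?E. ?s e = l}. Re (h n l * cnj (?C l) * (?w e * (?m' (?t e) * ?C' (?t e)))))"
      unfolding sum_by_src[OF n] by (intro sum.cong refl) (auto simp: algebra_simps)
    also have "\<dots> = (\<Sum>l\<in>{1..d}. Re (h n l * cnj (?C l) * (\<Sum>e\<in>{e \<in> ?E. ?s e = l}. ?w e * (LINT x:level (Suc n) (?t e) 0|\<mu>. u x))))"
      by (simp only: Re_sum[symmetric] sum_distrib_left[symmetric] base_average_times_mass[OF u(1,2) le_SucI[OF n]])
    also have "\<dots> = (\<Sum>l\<in>{1..d}. Re (h n l * cnj (?C l) * (base_mass n l * ?C l)))"
      by (simp only: integral_level_refine[OF n u(1,3) c] base_average_times_mass[OF u(1,2) n])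
    also have "\<dots> = energy u n"
    proof -
      have "of_nat a * cnj z * (complex_of_real b * z) = complex_of_real (real a * (b * (cmod z)\<^sup>2))" for a b z
        by (simp add: complex_norm_square del: of_real_power)
      then show ?thesis unfolding energy_def by (simp only: Re_complex_of_real)
    qed
    finally show ?thesis .
  qed
  have "(\<Sum>e\<in>?E. h n (?s e) * ?m' (?t e) * (cmod (?w e * ?C' (?t e) - ?C (?s e)))\<^sup>2) =
    (\<Sum>e\<in>?E. h n (?s e) * ?m' (?t e) * (cmod (?C' (?t e)))\<^sup>2) +
    (\<Sum>e\<in>?E. h n (?s e) * ?m' (?t e) * (cmod (?C (?s e)))\<^sup>2) -
    2 * (\<Sum>e\<in>?E. h n (?s e) * ?m' (?t e) * Re (?w e * ?C' (?t e) * cnj (?C (?s e))))"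
    unfolding expand norm_mult w sum_distrib_left sum.distrib[symmetric] sum_subtractf[symmetric]
    by (intro sum.cong refl) (simp only: mult_1 algebra_simps)
  then show ?thesis using S1 S2 S3 by simp
qed

lemma energy_increment_nonneg:
  fixes u :: "'a \<Rightarrow> complex"
  assumes "n \<ge> 1" "integrable \<mu> u" "AE x in \<mu>. cmod (u x) = 1" "AE x in \<mu>. u (T x) = c * u x" "cmod c = 1"
  shows "energy u n \<le> energy u (Suc n)"
  using energy_increment[OF assms] sum_nonneg[of "E (Suc n)"]
  by (smt (verit) measure_nonneg mult_nonneg_nonneg of_nat_0_le_iff zero_le_power2)

text \<open>The increments are nonnegative and telescope, with partial sums bounded by
  \<open>d\<close>. Index \<open>m\<close> stands for level \<open>m + 1\<close>.\<close>

lemma summable_energy_increment: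
  fixes u :: "'a \<Rightarrow> complex"
  assumes u: "integrable \<mu> u" "AE x in \<mu>. cmod (u x) = 1" "AE x in \<mu>. u (T x) = c * u x" and c: "cmod c = 1"
  shows "summable (\<lambda>m. energy u (Suc (Suc m)) - energy u (Suc m))"
proof (rule summableI_nonneg_bounded)
  show "0 \<le> energy u (Suc (Suc m)) - energy u (Suc m)" for m
    using energy_increment_nonneg[of "Suc m" u c] assms by simp
  have "0 \<le> energy u (Suc 0)"
    unfolding energy_def by (intro sum_nonneg) simp
  then show "(\<Sum>m<k. energy u (Suc (Suc m)) - energy u (Suc m)) \<le> d" for k
    using sum_lessThan_telescope[of "\<lambda>m. energy u (Suc m)" k] energy_le[OF u(1,2), of "Suc k"] by simp
qed

end

section \<open>Unit complex numbers and phases\<close>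

lemma scaled_unit_diff:
  fixes v w :: complex and a b :: real
  assumes "cmod v = 1" "cmod w = 1" "1/2 \<le> a" "1/2 \<le> b"
  shows "(cmod (v - w))\<^sup>2 \<le> 4 * (cmod (a * v - b * w))\<^sup>2"
proof -
  have vw: "(Re v)\<^sup>2 + (Im v)\<^sup>2 = 1" "(Re w)\<^sup>2 + (Im w)\<^sup>2 = 1"
    using assms(1,2) by (metis cmod_power2 one_power2)+
  define p where "p = Re v * Re w + Im v * Im w"
  have "(cmod (v - w))\<^sup>2 = ((Re v)\<^sup>2 + (Im v)\<^sup>2) + ((Re w)\<^sup>2 + (Im w)\<^sup>2) - 2 * p"
    unfolding p_def cmod_power2 by (simp add: power2_eq_square algebra_simps)
  moreover have "(cmod (a * v - b * w))\<^sup>2 = a\<^sup>2 * ((Re v)\<^sup>2 + (Im v)\<^sup>2) + b\<^sup>2 * ((Re w)\<^sup>2 + (Im w)\<^sup>2) - 2 * a * b * p"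
    unfolding p_def cmod_power2 by (simp add: power2_eq_square algebra_simps)
  \<comment> \<open>With \<open>p\<close> the real part of \<open>v * cnj w\<close>, the key
    identity is that the scaled squared distance is \<open>(a - b)\<^sup>2\<close> plus
    \<open>a * b\<close> times the unscaled one, and \<open>a * b\<close> is at least 1/4.\<close>
  ultimately have vw': "(cmod (v - w))\<^sup>2 = 2 - 2 * p" "(cmod (a * v - b * w))\<^sup>2 = (a - b)\<^sup>2 + a * b * (2 - 2 * p)"
    unfolding vw by (simp_all add: power2_eq_square algebra_simps)
  have "1/4 * (2 - 2 * p) \<le> a * b * (2 - 2 * p)"
    using mult_mono[OF assms(3,4)] assms(3,4) vw'(1) zero_le_power2[of "cmod (v - w)"]
    by (intro mult_right_mono) auto
  then have "2 - 2 * p \<le> 4 * (a * b * (2 - 2 * p))" by simp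
  also have "\<dots> \<le> 4 * ((a - b)\<^sup>2 + a * b * (2 - 2 * p))" by (intro mult_left_mono) simp_all
  finally show ?thesis unfolding vw' .
qed

lemma exp_power_add: "exp_power \<alpha> (a + b) = exp_power \<alpha> a * exp_power \<alpha> b"
  by (simp add: exp_power_def distrib_left exp_add)

lemma exp_power_minus: "exp_power \<alpha> (- a) = cnj (exp_power \<alpha> a)"
  by (simp add: exp_power_def exp_cnj)

lemma norm_exp_power: "cmod (exp_power \<alpha> a) = 1"
  by (simp add: exp_power_def)

lemma exp_power_nat: "exp_power \<alpha> (real n) = exp (2 * \<i> * of_real pi * of_real \<alpha>) ^ n"
  by (simp add: exp_power_def exp_of_nat2_mult[symmetric])

text \<open>For nonzero \<open>\<alpha>\<close> the real powers run through the whole unit circle,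
  so every argument is reached by rescaling.\<close>

lemma ex_exp_power_polar:
  assumes "\<alpha> \<noteq> 0"
  shows "\<exists>\<rho>. z = cmod z * exp_power \<alpha> \<rho>"
proof -
  have "z = cmod z * exp (\<i> * Arg z)"
    using Arg_eq by (cases "z = 0") auto
  then show ?thesis
    using assms by (intro exI[of _ "Arg z / (2 * pi * \<alpha>)"]) (simp add: exp_power_def field_simps)
qed

text \<open>The set where \<open>f\<close> does not vanish is invariant up to null sets, so
  ergodicity gives it full measure, and \<open>f\<close> can be divided by its modulus
  there.\<close>

lemma unimodular_eigenfunction:
  assumes "prob_space \<mu>" "ergodic T \<mu>" "eigenvalue_of T \<mu> c" and c: "cmod c = 1"
  shows "\<exists>u :: 'a \<Rightarrow> complex. integrable \<mu> u \<and> (AE x in \<mu>. cmod (u x) = 1) \<and> (AE x in \<mu>. u (T x) = c * u x)"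
proof -
  interpret prob_space \<mu> by fact
  have T: "T \<in> measurable \<mu> \<mu>" "distr \<mu> \<mu> T = \<mu>"
    and erg: "\<And>A. A \<in> sets \<mu> \<Longrightarrow> T -` A \<inter> space \<mu> = A \<Longrightarrow> measure \<mu> A = 0 \<or> measure \<mu> A = 1"
    using assms(2) unfolding ergodic_def by auto
  obtain f :: "'a \<Rightarrow> complex" where f: "f \<in> borel_measurable \<mu>" "\<not> (AE x in \<mu>. f x = 0)"
      "AE x in \<mu>. f (T x) = c * f x"
    using assms(3) unfolding eigenvalue_of_def by blast
  have Tn: "(T ^^ n) \<in> measurable \<mu> \<mu>" for n
    by (induction n) (use T(1) in \<open>auto intro: measurable_comp simp: id_def\<close>)
  have iter: "AE x in \<mu>. f ((T ^^ n) x) = c ^ n * f x" for n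
  proof (induction n)
    case (Suc n)
    have "AE x in distr \<mu> \<mu> T. f ((T ^^ n) x) = c ^ n * f x"
      by (subst T(2)) (rule Suc)
    then have "AE x in \<mu>. f ((T ^^ n) (T x)) = c ^ n * f (T x)"
      using T(1) by (rule AE_distrD[rotated])
    then show ?case
      using f(3) by eventually_elim (simp add: funpow_swap1)
  qed simp
  \<comment> \<open>Ergodicity is stated for strictly invariant sets. Eventual nonvanishing along
    the forward orbit is unaffected by a shift in time, so \<open>A\<close> is strictly invariant,
    and it agrees almost everywhere with the nonvanishing set of \<open>f\<close>.\<close>
  define A where "A = {x \<in> space \<mu>. \<exists>N. \<forall>n\<ge>N. f ((T ^^ n) x) \<noteq> 0}"
  have meas: "{x \<in> space \<mu>. f ((T ^^ n) x) \<noteq> 0} \<in> sets \<mu>" for n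
    using measurable_compose[OF Tn[of n] f(1)] by measurable
  have A: "A \<in> sets \<mu>"
    unfolding A_def using meas by measurable
  have "T -` A \<inter> space \<mu> = A"
  proof -
    have "(\<exists>N. \<forall>n\<ge>N. f ((T ^^ n) (T x)) \<noteq> 0) \<longleftrightarrow> (\<exists>N. \<forall>n\<ge>N. f ((T ^^ n) x) \<noteq> 0)" for x
    proof -
      have "(\<exists>N. \<forall>n\<ge>N. f ((T ^^ n) x) \<noteq> 0) \<longleftrightarrow> eventually (\<lambda>n. f ((T ^^ n) x) \<noteq> 0) sequentially"
        by (simp add: eventually_sequentially)
      also have "\<dots> \<longleftrightarrow> eventually (\<lambda>n. f ((T ^^ Suc n) x) \<noteq> 0) sequentially"
        by (rule eventually_sequentially_Suc[symmetric])
      also have "\<dots> \<longleftrightarrow> (\<exists>N. \<forall>n\<ge>N. f ((T ^^ n) (T x)) \<noteq> 0)"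
        by (simp add: eventually_sequentially funpow_swap1)
      finally show ?thesis by simp
    qed
    then show ?thesis using measurable_space[OF T(1)] by (auto simp: A_def)
  qed
  then have A01: "measure \<mu> A = 0 \<or> measure \<mu> A = 1" using erg A by simp
  have AE_A: "AE x in \<mu>. x \<in> A \<longleftrightarrow> f x \<noteq> 0"
  proof -
    have "AE x in \<mu>. \<forall>n. f ((T ^^ n) x) = c ^ n * f x"
      using iter by (simp add: AE_all_countable)
    then show ?thesis using AE_space
    proof eventually_elim
      case (elim x)
      have "c \<noteq> 0" using c by auto
      then show ?case using elim by (auto simp: A_def)
    qed
  qed
  have "measure \<mu> A \<noteq> 0"
  proof
    assume "measure \<mu> A = 0"
    then have "AE x in \<mu>. x \<notin> A"
      using A by (simp add: prob_eq_0)
    then have "AE x in \<mu>. f x = 0" using AE_A by eventually_elim simp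
    then show False using f(2) by simp
  qed
  then have "AE x in \<mu>. x \<in> A" using A01 A prob_eq_1 by blast
  then have nz: "AE x in \<mu>. f x \<noteq> 0" using AE_A by eventually_elim simp
  define u where "u x = f x / cmod (f x)" for x
  have u1: "AE x in \<mu>. cmod (u x) = 1"
    using nz by eventually_elim (simp add: u_def norm_divide)
  have u_meas: "u \<in> borel_measurable \<mu>"
    unfolding u_def using f(1) by measurable
  have "integrable \<mu> u"
    using u1 u_meas by (intro integrable_const_bound[of _ 1]) auto
  moreover have "AE x in \<mu>. u (T x) = c * u x"
    using f(3) by eventually_elim (simp add: u_def norm_mult c)
  ultimately show ?thesis using u1 by blast
qed

section \<open>From energy increments to the series\<close>

context vershik_system
begin

text \<open>A suffix vector depends on the path only through its edge at level \<open>n + 1\<close>,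
  so for nonnegative terms summing over edges can only increase the sum.\<close>

lemma suffix_sum_le:
  assumes "n \<ge> 1" "\<And>r. 0 \<le> (g r :: real)"
  shows "(\<Sum>v\<in>suffix_set d B n l k. g (height_pairing d B n v)) \<le>
    (\<Sum>e\<in>{e \<in> E (Suc n). s (Suc n) e = l \<and> t (Suc n) e = k}. g (suffix_height n e))"
proof -
  let ?S = "{e \<in> E (Suc n). s (Suc n) e = l \<and> t (Suc n) e = k}"
  \<comment> \<open>The constant function only carries \<open>e\<close>: \<open>suffix_vec\<close>
    reads the single value at \<open>n + 1\<close>.\<close>
  let ?f = "\<lambda>e. suffix_vec d B n (\<lambda>_. e)"
  have "suffix_set d B n l k \<subseteq> ?f ` ?S"
  proof
    fix v assume "v \<in> suffix_set d B n l k"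
    then obtain x where x: "x \<in> paths B" "path_vertex B n x = l" "path_vertex B (n + 1) x = k"
      "v = suffix_vec d B n x"
      unfolding suffix_set_def by blast
    then have "x (Suc n) \<in> ?S"
      using path_edge[OF x(1), of "Suc n"] path_src[OF x(1) assms(1)] assms(1) by (simp add: path_vertex_eq)
    moreover have "v = ?f (x (Suc n))" using x(4) by (simp add: suffix_vec_def)
    ultimately show "v \<in> ?f ` ?S" by blast
  qed
  then have "(\<Sum>v\<in>suffix_set d B n l k. g (height_pairing d B n v)) \<le> (\<Sum>v\<in>?f ` ?S. g (height_pairing d B n v))"
    using finite_edges[of "Suc n"] assms(2) by (intro sum_mono2) auto
  also have "\<dots> \<le> (\<Sum>e\<in>?S. ((\<lambda>v. g (height_pairing d B n v)) \<circ> ?f) e)"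
    using finite_edges[of "Suc n"] assms(2) by (intro sum_image_le) auto
  finally show ?thesis using assms(1) by (simp add: height_pairing_suffix_vec)
qed

text \<open>Each summand is at most four times the squared increment along its edge. All edges from
  \<open>l\<close> to \<open>k\<close> have the same weight \<open>?w\<close>, so these increments,
  weighted, form part of the nonnegative sum in \<open>energy_increment\<close>.\<close>

lemma pair_sum_le_energy_increment:
  fixes u :: "'a \<Rightarrow> complex"
  assumes n: "n \<ge> 1" and u: "integrable \<mu> u" "AE x in \<mu>. cmod (u x) = 1" "AE x in \<mu>. u (T x) = c * u x"
    and c: "c = exp (2 * \<i> * of_real pi * of_real \<alpha>)"
    and \<rho>: "\<And>n l. base_average u n l = cmod (base_average u n l) * exp_power \<alpha> (\<rho> n l)"
    and big: "1/2 \<le> cmod (base_average u n l)" "1/2 \<le> cmod (base_average u (Suc n) k)"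
    and \<delta>: "\<delta> > 0" "\<delta> \<le> measure \<mu> {x \<in> space \<mu>. path_vertex B n (\<phi> x) = l \<and> path_vertex B (n + 1) (\<phi> x) = k}"
  shows "1 / real (incidence B (n + 1) k l) * (\<Sum>v\<in>suffix_set d B n l k.
      (cmod (1 - exp_power \<alpha> (real (height_pairing d B n v) - \<rho> (n + 1) k + \<rho> n l)))\<^sup>2)
    \<le> 4 / \<delta> * (energy u (Suc n) - energy u n)"
proof -
  let ?S = "{e \<in> E (Suc n). s (Suc n) e = l \<and> t (Suc n) e = k}"
  let ?g = "\<lambda>r::nat. (cmod (1 - exp_power \<alpha> (real r - \<rho> (n + 1) k + \<rho> n l)))\<^sup>2"
  let ?D = "\<lambda>e. (cmod (cnj (c ^ suffix_height n e) * base_average u (Suc n) (t (Suc n) e) - base_average u n (s (Suc n) e)))\<^sup>2"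
  let ?M = "real (incidence B (n + 1) k l)"
  let ?w = "h n l * base_mass (Suc n) k"
  let ?sum = "\<Sum>v\<in>suffix_set d B n l k. ?g (height_pairing d B n v)"
  have c1: "cmod c = 1" by (simp add: c)
  have g: "?g (suffix_height n e) \<le> 4 * ?D e" if "e \<in> ?S" for e
  proof -
    let ?r = "suffix_height n e"
    \<comment> \<open>The phase of \<open>C\<^sub>n\<^sub>+\<^sub>1(k)\<close> after moving
      \<open>?r\<close> floors down from the top of its tower.\<close>
    define v where "v = exp_power \<alpha> (\<rho> (Suc n) k - real ?r)"
    have pw: "cnj (c ^ ?r) = exp_power \<alpha> (- real ?r)"
      unfolding exp_power_minus exp_power_nat c ..
    have "cnj (c ^ ?r) * base_average u (Suc n) k = cmod (base_average u (Suc n) k) * v"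
      unfolding pw v_def diff_conv_add_uminus exp_power_add by (subst \<rho>) (simp add: mult_ac)
    then have D: "?D e = (cmod (cmod (base_average u (Suc n) k) * v - cmod (base_average u n l) * exp_power \<alpha> (\<rho> n l)))\<^sup>2"
      using that \<rho>[of n l] by simp
    have "v * (1 - exp_power \<alpha> (real ?r - \<rho> (Suc n) k + \<rho> n l)) = v - exp_power \<alpha> (\<rho> n l)"
      by (simp add: v_def right_diff_distrib flip: exp_power_add)
    then have "cmod (1 - exp_power \<alpha> (real ?r - \<rho> (Suc n) k + \<rho> n l)) = cmod (v - exp_power \<alpha> (\<rho> n l))"
      using norm_mult[of v] norm_exp_power by (metis mult_1 v_def)
    then show ?thesis
      unfolding D using scaled_unit_diff[OF _ _ big(2,1), of v "exp_power \<alpha> (\<rho> n l)"]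
      by (simp add: v_def norm_exp_power)
  qed
  have "?sum \<le> (\<Sum>e\<in>?S. ?g (suffix_height n e))"
    by (rule suffix_sum_le[OF n]) simp
  also have "\<dots> \<le> (\<Sum>e\<in>?S. 4 * ?D e)"
    using g by (intro sum_mono) blast
  finally have 1: "?sum \<le> (\<Sum>e\<in>?S. 4 * ?D e)" .
  have "?w * (\<Sum>e\<in>?S. 4 * ?D e) =
      4 * (\<Sum>e\<in>?S. h n (s (Suc n) e) * base_mass (Suc n) (t (Suc n) e) * ?D e)"
    unfolding sum_distrib_left by (intro sum.cong refl) simp
  also have "\<dots> \<le> 4 * (\<Sum>e\<in>E (Suc n). h n (s (Suc n) e) * base_mass (Suc n) (t (Suc n) e) * ?D e)"
    using finite_edges[of "Suc n"] by (intro mult_left_mono sum_mono2) auto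
  also have "\<dots> = 4 * (energy u (Suc n) - energy u n)"
    by (simp only: energy_increment[OF n u c1])
  finally have 2: "?w * (\<Sum>e\<in>?S. 4 * ?D e) \<le> 4 * (energy u (Suc n) - energy u n)" .
  \<comment> \<open>The weight of one edge is at least \<open>\<delta> / ?M\<close>, which absorbs
    the factor \<open>1 / ?M\<close> of the series.\<close>
  have 3: "\<delta> \<le> ?M * ?w" using \<delta>(2) measure_two_levels_le[OF n, of l k] by simp
  then have M: "?M > 0" using \<delta>(1) by (cases "?M = 0") auto
  have "\<delta> * ?sum \<le> ?M * ?w * ?sum"
    using 3 by (intro mult_right_mono sum_nonneg) auto
  also have "\<dots> \<le> ?M * (?w * (\<Sum>e\<in>?S. 4 * ?D e))"
    unfolding mult.assoc using 1 by (intro mult_left_mono) auto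
  also have "\<dots> \<le> ?M * (4 * (energy u (Suc n) - energy u n))"
    using 2 by (intro mult_left_mono) auto
  finally show ?thesis
    using M \<delta>(1) by (simp add: field_simps)
qed

text \<open>For a recurrent pair both towers eventually have mass at least a fixed
  \<open>\<delta>\<close>, so both averages have modulus at least 1/2 and the energy increments
  dominate the terms.\<close>

lemma summable_pair_sum:
  fixes u :: "'a \<Rightarrow> complex"
  assumes u: "integrable \<mu> u" "AE x in \<mu>. cmod (u x) = 1" "AE x in \<mu>. u (T x) = c * u x"
    and c: "c = exp (2 * \<i> * of_real pi * of_real \<alpha>)"
    and \<rho>: "\<And>n l. base_average u n l = cmod (base_average u n l) * exp_power \<alpha> (\<rho> n l)"
    and J: "(l, k) \<in> recurrent_pairs d (\<lambda>n x. path_vertex B n (\<phi> x)) \<mu>"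
  shows "summable (\<lambda>m. 1 / real (incidence B (Suc m + 1) k l) * (\<Sum>v\<in>suffix_set d B (Suc m) l k.
      (cmod (1 - exp_power \<alpha> (real (height_pairing d B (Suc m) v) - \<rho> (Suc m + 1) k + \<rho> (Suc m) l)))\<^sup>2))"
    (is "summable ?a")
proof -
  let ?P = "\<lambda>n. measure \<mu> {x \<in> space \<mu>. path_vertex B n (\<phi> x) = l \<and> path_vertex B (n + 1) (\<phi> x) = k}"
  have c1: "cmod c = 1" by (simp add: c)
  have "0 < liminf (\<lambda>n. ereal (?P n))" using J by (simp add: recurrent_pairs_def)
  then obtain \<delta> where \<delta>: "0 < ereal \<delta>" "ereal \<delta> < liminf (\<lambda>n. ereal (?P n))"
    using ereal_dense2 by blast
  obtain N1 where N1: "\<forall>n\<ge>N1. \<delta> < ?P n"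
    using less_LiminfD[OF \<delta>(2)] by (auto simp: eventually_sequentially)
  have "\<delta> > 0" using \<delta>(1) by simp
  obtain N2 where N2: "N2 \<ge> 1" "\<And>n l. n \<ge> N2 \<Longrightarrow> \<delta> \<le> measure \<mu> {x \<in> space \<mu>. path_vertex B n (\<phi> x) = l} \<Longrightarrow>
      base_mass n l \<le> 2 * cmod (LINT x:level n l 0|\<mu>. u x)"
    using average_lower_bound[OF u c1 \<open>\<delta> > 0\<close>] by blast
  have half: "1/2 \<le> cmod (base_average u n j)"
    if "n \<ge> N2" "\<delta> \<le> measure \<mu> {x \<in> space \<mu>. path_vertex B n (\<phi> x) = j}" for n j
  proof -
    have "base_mass n j \<noteq> 0"
      using that measure_tower[of n j] N2(1) \<open>\<delta> > 0\<close> by auto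
    then have "base_mass n j > 0" using zero_less_measure_iff by blast
    then show ?thesis
      using N2(2)[OF that] by (simp add: base_average_def norm_divide field_simps)
  qed
  have tower: "{x \<in> space \<mu>. path_vertex B n (\<phi> x) = j} \<in> sets \<mu>" if "n \<ge> 1" for n j
    using level_sets that by (simp add: tower_eq)
  have le: "?a m \<le> 4 / \<delta> * (energy u (Suc (Suc m)) - energy u (Suc m))" if m: "m \<ge> N1 + N2" for m
  proof -
    have P: "\<delta> \<le> ?P (Suc m)" using N1 m by (intro less_imp_le) simp
    \<comment> \<open>The two-level set lies in each of the two towers, so a lower bound for its
      mass serves both.\<close>
    have "?P (Suc m) \<le> measure \<mu> {x \<in> space \<mu>. path_vertex B (Suc m) (\<phi> x) = l}"
      "?P (Suc m) \<le> measure \<mu> {x \<in> space \<mu>. path_vertex B (Suc (Suc m)) (\<phi> x) = k}"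
      by (intro finite_measure_mono tower; auto)+
    then have "1/2 \<le> cmod (base_average u (Suc m) l)" "1/2 \<le> cmod (base_average u (Suc (Suc m)) k)"
      using half[of "Suc m" l] half[of "Suc (Suc m)" k] P m by auto
    then show ?thesis
      using P \<open>\<delta> > 0\<close> by (intro pair_sum_le_energy_increment[OF _ u c \<rho>]) auto
  qed
  have nonneg: "0 \<le> ?a m" for m by (intro mult_nonneg_nonneg sum_nonneg) auto
  have "eventually (\<lambda>m. norm (?a m) \<le> 4 / \<delta> * (energy u (Suc (Suc m)) - energy u (Suc m))) sequentially"
    unfolding eventually_sequentially real_norm_def abs_of_nonneg[OF nonneg] using le by blast
  then show ?thesis
    using summable_mult[OF summable_energy_increment[OF u c1], of "4 / \<delta>"]
    by (rule summable_comparison_test_ev)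
qed

end

text \<open>A maximum of finitely many nonnegative terms is bounded by their sum; for empty
  \<open>J\<close> both are 0.\<close>

lemma summable_max_or_zero:
  fixes a :: "'b \<Rightarrow> nat \<Rightarrow> real"
  assumes "finite J" "\<And>j. j \<in> J \<Longrightarrow> summable (a j)" "\<And>j m. j \<in> J \<Longrightarrow> 0 \<le> a j m"
  shows "summable (\<lambda>m. max_or_zero ((\<lambda>j. a j m) ` J))"
proof (rule summable_comparison_test)
  show "summable (\<lambda>m. \<Sum>j\<in>J. a j m)" using assms(2) by (rule summable_sum)
  have "0 \<le> max_or_zero ((\<lambda>j. a j m) ` J) \<and> max_or_zero ((\<lambda>j. a j m) ` J) \<le> (\<Sum>j\<in>J. a j m)" for m
  proof (cases "J = {}")
    case False
    then have "Max ((\<lambda>j. a j m) ` J) \<in> (\<lambda>j. a j m) ` J" using assms(1) by (intro Max_in) auto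
    then obtain j where "j \<in> J" "Max ((\<lambda>j. a j m) ` J) = a j m" by blast
    then show ?thesis using False assms(1,3) by (auto simp: max_or_zero_def intro: member_le_sum)
  qed (simp add: max_or_zero_def)
  then show "\<exists>N. \<forall>m\<ge>N. norm (max_or_zero ((\<lambda>j. a j m) ` J)) \<le> (\<Sum>j\<in>J. a j m)" by simp
qed

theorem proposition18:
  fixes X :: "'a topology" and T :: "'a \<Rightarrow> 'a" and \<mu> :: "'a measure"
    and d :: nat and B :: "'e bratteli" and \<phi> :: "'a \<Rightarrow> nat \<Rightarrow> 'e"
    and \<tau> :: "nat \<Rightarrow> 'a \<Rightarrow> nat" and c :: complex and \<alpha> :: real
  assumes "cantor_minimal_system X T"
    and "borel_prob_measure X \<mu>" and "ergodic T \<mu>"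
    and "given_by X T d B \<phi>" and "standing_assumptions d B"
    and "\<tau> = (\<lambda>n x. path_vertex B n (\<phi> x))"
    and "clean d \<tau> \<mu>"
    and "c = exp (2 * \<i> * of_real pi * of_real \<alpha>)" and "eigenvalue_of T \<mu> c"
  shows "\<exists>\<rho> :: nat \<Rightarrow> nat \<Rightarrow> real.
    summable (\<lambda>m. let n = Suc m in
      max_or_zero ((\<lambda>(l, k).
          1 / real (incidence B (n + 1) k l) *
          (\<Sum>s\<in>suffix_set d B n l k.
             (cmod (1 - exp_power \<alpha> (real (height_pairing d B n s) - \<rho> (n + 1) k + \<rho> n l)))\<^sup>2))
        ` recurrent_pairs d \<tau> \<mu>))"
proof -
  have sys: "vershik_system d B X T \<mu> \<phi>"
    using assms(2-5)
    by (simp add: vershik_system_def vershik_system_axioms_def bratteli_vershik_def ergodic_def given_by_def)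
  interpret vershik_system d B X T \<mu> \<phi> by (rule sys)
  let ?J = "recurrent_pairs d \<tau> \<mu>"
  let ?a = "\<lambda>\<rho> (l, k) m. 1 / real (incidence B (Suc m + 1) k l) * (\<Sum>s\<in>suffix_set d B (Suc m) l k.
      (cmod (1 - exp_power \<alpha> (real (height_pairing d B (Suc m) s) - \<rho> (Suc m + 1) k + \<rho> (Suc m) l)))\<^sup>2)"
  have fin: "finite ?J"
    by (rule finite_subset[of _ "{1..d} \<times> {1..d}"]) (auto simp: recurrent_pairs_def)
  have "\<exists>\<rho>. \<forall>j\<in>?J. summable (?a \<rho> j)"
  \<comment> \<open>For \<open>\<alpha> = 0\<close> every power is 1 and all terms vanish, whatever
    \<open>\<rho>\<close> is; otherwise \<open>\<rho>\<close> records the phases of the averages,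
    one choice serving all pairs at once.\<close>
  proof (cases "\<alpha> = 0")
    case True
    then show ?thesis by (auto simp: exp_power_def)
  next
    case False
    obtain u :: "'a \<Rightarrow> complex" where u: "integrable \<mu> u" "AE x in \<mu>. cmod (u x) = 1" "AE x in \<mu>. u (T x) = c * u x"
      using unimodular_eigenfunction[OF prob_space_axioms assms(3,9)] assms(8) by auto
    have "\<forall>n l. \<exists>r. base_average u n l = cmod (base_average u n l) * exp_power \<alpha> r"
      using ex_exp_power_polar[OF False] by blast
    then obtain \<rho> where "\<And>n l. base_average u n l = cmod (base_average u n l) * exp_power \<alpha> (\<rho> n l)"
      by metis
    then have "summable (?a \<rho> j)" if "j \<in> ?J" for j
      using summable_pair_sum[OF u assms(8), of \<rho> "fst j" "snd j"] that assms(6)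
      by (simp add: case_prod_unfold)
    then show ?thesis by blast
  qed
  then obtain \<rho> where \<rho>: "\<forall>j\<in>?J. summable (?a \<rho> j)" by (rule exE)
  have "summable (\<lambda>m. max_or_zero ((\<lambda>j. ?a \<rho> j m) ` ?J))"
    using fin bspec[OF \<rho>] by (rule summable_max_or_zero) (auto intro!: divide_nonneg_nonneg sum_nonneg)
  then show ?thesis
    by (intro exI[of _ \<rho>]) (simp add: Let_def case_prod_unfold)
qed

end
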